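(* Let $X,Y$ be sets and let $B=X\times Y$ be the rectangular band with multiplication $(x_1,y_1)(x_2,y_2)=(x_1,y_2)$. (a) If $|X|\neq|Y|$, then $\operatorname{Aut}^-(B)=\emptyset$ and $\mathscr C(B)=\{\mathrm{id}_B\}$. (b) Suppose $|X|=|Y|$; without loss of generality $X=Y$, so $B=X\times X$. For $\sigma,\tau\in\operatorname{Sym}(X)$ define $\gamma_{\sigma,\tau},\delta_{\sigma,\tau}:B\to B$ by $\gamma_{\sigma,\tau}(x,y)=(\sigma(x),\tau(y))$ and $\delta_{\sigma,\tau}(x,y)=(\sigma(y),\tau(x))$. Then $$\operatorname{Aut}(B)=\{\gamma_{\sigma,\tau}:\sigma,\tau\in\operatorname{Sym}(X)\}\cong\operatorname{Sym}(X)\times\operatorname{Sym}(X),\qquad \operatorname{Aut}^-(B)=\{\delta_{\sigma,\tau}:\sigma,\tau\in\operatorname{Sym}(X)\},$$ $$I(B)=\{\delta_{\sigma,\sigma^{-1}}:\sigma\in\operatorname{Sym}(X)\},\qquad \operatorname{Aut}^{\pm}(B)=\{\gamma_{\sigma,\tau},\delta_{\sigma,\tau}:\sigma,\tau\in\operatorname{Sym}(X)\}\cong\operatorname{Sym}(X)\wr\mathbb Z_2.$$ If $X$ is infinite, then $\mathscr C(B)=\operatorname{Aut}^{\pm}(B)\cong\operatorname{Sym}(X)\wr\mathbb Z_2$. If $X$ is finite, then $$\mathscr C(B)=\{\gamma_{\sigma,\tau},\delta_{\sigma,\tau}:\sigma,\tau\in\operatorname{Sym}(X),\ \sigma\tau\in\operatorname{Alt}(X)\}\cong\big((\operatorname{Alt}(X)\times\operatorname{Alt}(X))\rtimes\mathbb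 Z_2\big)\rtimes\mathbb Z_2 ,$$ where $(\operatorname{Alt}(X)\times\operatorname{Alt}(X))\rtimes\mathbb Z_2$ is the group $K=\{(\sigma,\tau)\in\operatorname{Sym}(X)\times\operatorname{Sym}(X):\sigma\tau\in\operatorname{Alt}(X)\}=(\operatorname{Alt}(X)\times\operatorname{Alt}(X))\rtimes\langle(\pi,\pi)\rangle$ for any fixed odd permutation $\pi$ of order $2$, and the outer $\mathbb Z_2$ acts on $K$ by interchanging the two coordinates.
   Context: $\operatorname{Sym}(X)$ is the group of all permutations of $X$, and (for finite $X$) $\operatorname{Alt}(X)$ is the subgroup of even permutations. For a group $G$, $G\wr\mathbb Z_2=(G\times G)\rtimes\mathbb Z_2$ is the wreath product where $\mathbb Z_2$ acts by interchanging the coordinates. For a semigroup $S$: $\operatorname{Aut}(S)$ is the set of automorphisms of $S$; $\operatorname{Aut}^-(S)$ is the set of anti-automorphisms, i.e. bijections $\alpha:S\to S$ with $\alpha(xy)=\alpha(y)\alpha(x)$ for all $x,y\in S$; $\operatorname{Aut}^{\pm}(S)=\operatorname{Aut}(S)\cup\operatorname{Aut}^-(S)$, a group under composition. $I(S)=\{\alpha\in\operatorname{Aut}^-(S):\alpha^2=\mathrm{id}_S\neq\alpha\}$ is the set of involutions of $S$, and $\mathscr C(S)=\langle I(S)\rangle\le\operatorname{Aut}^{\pm}(S)$, interpreted as $\{\mathrm{id}_S\}$ if $I(S)=\emptyset$.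
   Formalization: In (a), X and Y are assumed nonempty (else B and Aut^-(B)={id}); the formula for I(B), Aut^±(B) ≅ Sym(X) wr Z_2 and the isomorphism for C(B) with X finite are stated for |X| ≥ 2, since they fail for |X| ≤ 1. *)

theory Defs
  imports
    "HOL-Algebra.Sym_Groups"
    "HOL-Algebra.Elementary_Groups"
    "HOL-Algebra.Multiplicative_Group"
    "HOL-Library.Equipollence"
begin

section \<open>Symmetric and alternating groups of a set\<close>

text \<open>As in \<^theory>\<open>HOL-Algebra.Sym_Groups\<close>, a permutation of \<open>X\<close> is a total function that
  fixes every point outside \<open>X\<close> (\<open>permutes\<close>), so composition is \<open>(\<circ>)\<close> and the identity is
  \<open>id\<close>. The set \<open>X\<close> may be infinite.\<close>

definition Sym :: "'a set \<Rightarrow> ('a \<Rightarrow> 'a) set" where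
  "Sym X = {p. p permutes X}"

definition symmetric_group :: "'a set \<Rightarrow> ('a \<Rightarrow> 'a) monoid" where
  "symmetric_group X = \<lparr>carrier = Sym X, mult = (\<circ>), one = id\<rparr>"

text \<open>Only meant for finite \<open>X\<close>.\<close>

definition Alt :: "'a set \<Rightarrow> ('a \<Rightarrow> 'a) set" where
  "Alt X = {p \<in> Sym X. evenperm p}"


section \<open>Semidirect and wreath products\<close>

text \<open>External semidirect product with respect to an action \<open>\<theta>\<close> of \<open>H\<close> on \<open>N\<close> by
  automorphisms; that \<open>\<theta>\<close> is such an action is left to the uses of the definition.\<close>

definition semidirect ::
  "('n, 'r) monoid_scheme \<Rightarrow> ('h, 's) monoid_scheme \<Rightarrow> ('h \<Rightarrow> 'n \<Rightarrow> 'n) \<Rightarrow> ('n \<times> 'h) monoid"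
  where
  "semidirect N H \<theta> =
    \<lparr>carrier = carrier N \<times> carrier H,
     mult = (\<lambda>(n\<^sub>1, h\<^sub>1) (n\<^sub>2, h\<^sub>2). (n\<^sub>1 \<otimes>\<^bsub>N\<^esub> \<theta> h\<^sub>1 n\<^sub>2, h\<^sub>1 \<otimes>\<^bsub>H\<^esub> h\<^sub>2)),
     one = (\<one>\<^bsub>N\<^esub>, \<one>\<^bsub>H\<^esub>)\<rparr>"

abbreviation Z2 :: "int monoid" where
  "Z2 \<equiv> integer_mod_group 2"

definition swap_action :: "int \<Rightarrow> 'a \<times> 'a \<Rightarrow> 'a \<times> 'a" where
  "swap_action k = (if k = 0 then id else prod.swap)"

definition wreath_Z2 :: "('g, 'r) monoid_scheme \<Rightarrow> (('g \<times> 'g) \<times> int) monoid" where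
  "wreath_Z2 G = semidirect (G \<times>\<times> G) Z2 swap_action"

definition internal_semidirect :: "('g, 'r) monoid_scheme \<Rightarrow> 'g set \<Rightarrow> 'g set \<Rightarrow> bool" where
  "internal_semidirect G N H \<longleftrightarrow>
    N \<lhd> G \<and> subgroup H G \<and> N \<inter> H = {\<one>\<^bsub>G\<^esub>} \<and> N <#>\<^bsub>G\<^esub> H = carrier G"


section \<open>Automorphisms and anti-automorphisms of a semigroup\<close>

text \<open>A semigroup is given by its carrier \<open>S\<close> and its multiplication \<open>m\<close>. Bijections of \<open>S\<close>
  are again represented as total functions fixing every point outside \<open>S\<close>.\<close>

definition Aut :: "'s set \<Rightarrow> ('s \<Rightarrow> 's \<Rightarrow> 's) \<Rightarrow> ('s \<Rightarrow> 's) set" where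
  "Aut S m = {\<alpha>. \<alpha> permutes S \<and> (\<forall>x\<in>S. \<forall>y\<in>S. \<alpha> (m x y) = m (\<alpha> x) (\<alpha> y))}"

definition AntiAut :: "'s set \<Rightarrow> ('s \<Rightarrow> 's \<Rightarrow> 's) \<Rightarrow> ('s \<Rightarrow> 's) set" where
  "AntiAut S m = {\<alpha>. \<alpha> permutes S \<and> (\<forall>x\<in>S. \<forall>y\<in>S. \<alpha> (m x y) = m (\<alpha> y) (\<alpha> x))}"

definition AutPM :: "'s set \<Rightarrow> ('s \<Rightarrow> 's \<Rightarrow> 's) \<Rightarrow> ('s \<Rightarrow> 's) set" where
  "AutPM S m = Aut S m \<union> AntiAut S m"

definition Aut_group :: "'s set \<Rightarrow> ('s \<Rightarrow> 's \<Rightarrow> 's) \<Rightarrow> ('s \<Rightarrow> 's) monoid" where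
  "Aut_group S m = \<lparr>carrier = Aut S m, mult = (\<circ>), one = id\<rparr>"

definition AutPM_group :: "'s set \<Rightarrow> ('s \<Rightarrow> 's \<Rightarrow> 's) \<Rightarrow> ('s \<Rightarrow> 's) monoid" where
  "AutPM_group S m = \<lparr>carrier = AutPM S m, mult = (\<circ>), one = id\<rparr>"

definition Involutions :: "'s set \<Rightarrow> ('s \<Rightarrow> 's \<Rightarrow> 's) \<Rightarrow> ('s \<Rightarrow> 's) set" where
  "Involutions S m = {\<alpha> \<in> AntiAut S m. \<alpha> \<circ> \<alpha> = id \<and> \<alpha> \<noteq> id}"

definition InvGen :: "'s set \<Rightarrow> ('s \<Rightarrow> 's \<Rightarrow> 's) \<Rightarrow> ('s \<Rightarrow> 's) set" where
  "InvGen S m = generate (AutPM_group S m) (Involutions S m)"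

definition InvGen_group :: "'s set \<Rightarrow> ('s \<Rightarrow> 's \<Rightarrow> 's) \<Rightarrow> ('s \<Rightarrow> 's) monoid" where
  "InvGen_group S m = (AutPM_group S m)\<lparr>carrier := InvGen S m\<rparr>"

definition semigroup_isomorphic ::
  "'s set \<Rightarrow> ('s \<Rightarrow> 's \<Rightarrow> 's) \<Rightarrow> 't set \<Rightarrow> ('t \<Rightarrow> 't \<Rightarrow> 't) \<Rightarrow> bool" where
  "semigroup_isomorphic S m T m' \<longleftrightarrow>
    (\<exists>f. bij_betw f S T \<and> (\<forall>x\<in>S. \<forall>y\<in>S. f (m x y) = m' (f x) (f y)))"


section \<open>Rectangular bands\<close>

text \<open>The rectangular band on \<open>X \<times> Y\<close> is the semigroup with carrier \<open>X \<times> Y\<close> and this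
  multiplication.\<close>

definition rect :: "'a \<times> 'b \<Rightarrow> 'a \<times> 'b \<Rightarrow> 'a \<times> 'b" where
  "rect p q = (fst p, snd q)"

definition gam :: "'a set \<Rightarrow> ('a \<Rightarrow> 'a) \<Rightarrow> ('a \<Rightarrow> 'a) \<Rightarrow> 'a \<times> 'a \<Rightarrow> 'a \<times> 'a" where
  "gam X \<sigma> \<tau> = (\<lambda>(x, y). if (x, y) \<in> X \<times> X then (\<sigma> x, \<tau> y) else (x, y))"

definition del :: "'a set \<Rightarrow> ('a \<Rightarrow> 'a) \<Rightarrow> ('a \<Rightarrow> 'a) \<Rightarrow> 'a \<times> 'a \<Rightarrow> 'a \<times> 'a" where
  "del X \<sigma> \<tau> = (\<lambda>(x, y). if (x, y) \<in> X \<times> X then (\<sigma> y, \<tau> x) else (x, y))"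

definition EvenPairs :: "'a set \<Rightarrow> (('a \<Rightarrow> 'a) \<times> ('a \<Rightarrow> 'a)) set" where
  "EvenPairs X = {(\<sigma>, \<tau>). \<sigma> \<in> Sym X \<and> \<tau> \<in> Sym X \<and> \<sigma> \<circ> \<tau> \<in> Alt X}"

definition EvenPairs_group :: "'a set \<Rightarrow> (('a \<Rightarrow> 'a) \<times> ('a \<Rightarrow> 'a)) monoid" where
  "EvenPairs_group X = (symmetric_group X \<times>\<times> symmetric_group X)\<lparr>carrier := EvenPairs X\<rparr>"

end

(* An automorphism of the rectangular band acts separately on the two coordinates, and an
   anti-automorphism does so after interchanging them. Modulo the elements gam s (s^-1), which are
   products of two involutions, the group generated by the involutions is therefore governed by the
   elements gam id t it contains; these t are closed under composition and contain all commutators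
   of Sym X. For infinite X the symmetric group is perfect: every permutation is a product of two
   permutations that each fix a subset of full cardinality pointwise, and those are commutators by a
   shift (infinite swindle) argument. For finite X the commutators generate Alt X, because a product
   of two transpositions is a commutator, while the generators themselves have even parity. *)
theory Submission
  imports Defs
begin

section \<open>Commutators in symmetric groups\<close>

text \<open>The pairs \<open>(\<sigma>, inv' \<sigma>)\<close> are not closed under products unless
  \<open>Sym X\<close> is commutative, and commutators measure exactly this failure; that is how
  they appear alone in the second coordinate. Whether \<open>gam X \<sigma> \<tau>\<close> is
  generated depends only on \<open>\<sigma> \<circ> \<tau>\<close>, so a subset of
  \<open>Sym X\<close> describes the whole group, and one parity condition settles the finite case.
  The shift argument needs room: infinitely many copies of the moved points must fit into the fixed
  points. A permutation of an infinite set may have no fixed point at all, which forces the prior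
  factorisation. Both factors come with a fixed set of the full cardinality of \<open>X\<close>, so
  the argument works for uncountable \<open>X\<close> as well.\<close>

lemma infinite_eqpoll_Times_int:
  assumes "infinite A" "K \<noteq> {}"
  shows "A \<times> (K :: int set) \<approx> A"
proof -
  have "K \<lesssim> (UNIV :: nat set)"
    using countable_subset[of K UNIV] by (auto simp: countable_def lepoll_def)
  also have "\<dots> \<lesssim> A"
    using assms(1) by (simp add: infinite_le_lepoll)
  finally have "ordLeq3 (card_of K) (card_of A)"
    by (auto simp: lepoll_def simp flip: card_of_ordLeq)
  then show ?thesis
    by (simp add: eqpoll_iff_card_of_ordIso card_of_Times_infinite_simps assms)
qed

lemma infinite_obtain_two:
  assumes "infinite A"
  obtains x y where "x \<in> A" "y \<in> A" "x \<noteq> y"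
  using assms by (metis finite.emptyI is_singletonI' is_singleton_def finite.insertI)

text \<open>A bijection from \<open>A \<times> UNIV\<close> onto \<open>A\<close> carries copy 0 and
  the union of all other copies to the two halves.\<close>

lemma infinite_split:
  assumes "infinite A"
  obtains B C where "A = B \<union> C" "B \<inter> C = {}" "B \<approx> A" "C \<approx> A"
proof -
  obtain f where f: "bij_betw f (A \<times> (UNIV :: int set)) A"
    using infinite_eqpoll_Times_int[OF assms, of UNIV] by (auto simp: eqpoll_def)
  have inj: "inj_on f (A \<times> UNIV)" and im: "f ` (A \<times> UNIV) = A"
    using f by (auto simp: bij_betw_def)
  have part: "f ` (A \<times> K) \<approx> A" if "K \<noteq> {}" for K :: "int set"
  proof -
    have "f ` (A \<times> K) \<approx> A \<times> K"
      by (rule inj_on_image_eqpoll_self) (rule inj_on_subset[OF inj], auto)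
    then show ?thesis
      using infinite_eqpoll_Times_int[OF assms that] eqpoll_trans by blast
  qed
  show ?thesis
  proof
    show "A = f ` (A \<times> {0}) \<union> f ` (A \<times> (- {0}))"
      using im by (simp add: image_Un[symmetric] Sigma_Un_distrib2[symmetric])
    show "f ` (A \<times> {0}) \<inter> f ` (A \<times> (- {0})) = {}"
      using inj by (auto simp: inj_on_def)
    have "1 \<in> - {0::int}" by simp
    then have "- {0::int} \<noteq> {}" by (metis empty_iff)
    then show "f ` (A \<times> (- {0})) \<approx> A" by (rule part)
  qed (auto intro: part)
qed

text \<open>The union of two sets strictly smaller than an infinite set is again strictly smaller,
  so one part must have full size.\<close>

lemma eqpoll_Un_infiniteD:
  assumes "infinite X" "A \<union> B \<approx> X"
  shows "A \<approx> X \<or> B \<approx> X"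
proof -
  have "A \<lesssim> X" "B \<lesssim> X"
    using assms(2) by (meson Un_upper1 Un_upper2 lepoll_trans2 subset_imp_lepoll)+
  moreover have "\<not> (A \<prec> X \<and> B \<prec> X)"
  proof
    assume "A \<prec> X \<and> B \<prec> X"
    moreover have "ordLess2 (card_of C) (card_of X)" if "C \<prec> X" for C
    proof -
      have "ordLeq3 (card_of C) (card_of X)" "\<not> ordIso2 (card_of C) (card_of X)"
        using that by (auto simp: lesspoll_def eqpoll_iff_card_of_ordIso lepoll_def card_of_ordLeq)
      then show ?thesis using ordLeq_iff_ordLess_or_ordIso by blast
    qed
    ultimately have "ordLess2 (card_of (A \<union> B)) (card_of X)"
      using card_of_Un_ordLess_infinite[OF assms(1)] by blast
    then show False
      using assms(2) not_ordLess_ordIso by (auto simp: eqpoll_iff_card_of_ordIso)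
  qed
  ultimately show ?thesis
    by (auto simp: lepoll_iff_leqpoll)
qed

lemma eqpoll_between:
  assumes "A \<subseteq> B" "B \<subseteq> X" "A \<approx> X"
  shows "B \<approx> X"
  using subset_imp_lepoll[OF assms(2)]
    lepoll_trans1[OF eqpoll_sym[OF assms(3)] subset_imp_lepoll[OF assms(1)]]
  by (rule lepoll_antisym)

text \<open>Infinitely many copies of \<open>X - E\<close>, indexed by the integers, fit into \<open>X\<close>, with \<open>\<tau>\<close>
  living on copy \<open>0\<close>. If \<open>p\<close> acts as \<open>\<tau>\<close> on all copies with nonnegative index and \<open>s\<close> shifts the index,
  then \<open>p\<close> and \<open>s p s\<inverse>\<close> differ exactly by \<open>\<tau>\<close> on copy \<open>0\<close>.\<close>

lemma commutator_if_fixes_large_set: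
  assumes "infinite X" and \<tau>: "\<tau> permutes X" and E: "E \<subseteq> X" "E \<approx> X"
    and fixes_E: "\<forall>x\<in>E. \<tau> x = x"
  obtains p s where "p permutes X" "s permutes X" "\<tau> = p \<circ> s \<circ> inv' p \<circ> inv' s"
proof -
  have "infinite E" using assms eqpoll_finite_iff by blast
  then obtain E1 E2 where E12: "E = E1 \<union> E2" "E1 \<inter> E2 = {}" "E1 \<approx> E" "E2 \<approx> E"
    by (rule infinite_split)
  \<comment> \<open>Only \<open>E1\<close> receives the copies with nonzero index. Keeping
    \<open>E2\<close> inside \<open>A\<close> makes \<open>A\<close> as large as \<open>X\<close>
    even if \<tau> moves few points, so that \<open>A \<times> (- {0})\<close> fills
    \<open>E1\<close> exactly.\<close>
  define A where "A = X - E1"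
  have A: "A \<approx> X"
  proof (rule eqpoll_between[rotated 2])
    show "E2 \<approx> X" using E12(4) E(2) eqpoll_trans by blast
  qed (use E12 E in \<open>auto simp: A_def\<close>)
  then have "infinite A" using assms(1) eqpoll_finite_iff by blast
  moreover have "1 \<in> - {0::int}" by simp
  then have "- {0::int} \<noteq> {}" by (metis empty_iff)
  ultimately have "A \<times> (- {0::int}) \<approx> A" by (rule infinite_eqpoll_Times_int)
  then have "A \<times> (- {0::int}) \<approx> E1"
    by (meson A E(2) E12(3) eqpoll_sym eqpoll_trans)
  then obtain f' where f': "bij_betw f' (A \<times> (- {0::int})) E1"
    by (auto simp: eqpoll_def)
  \<comment> \<open>Copy 0 is \<open>A\<close> itself, embedded identically; hence transporting
    \<open>t\<close> along \<open>f\<close> gives back \<tau> and not merely a conjugate of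
    it.\<close>
  define f where "f = (\<lambda>(a, k). if k = 0 then a else f' (a, k))"
  let ?T = "A \<times> (UNIV :: int set)"
  have "bij_betw f (A \<times> {0} \<union> A \<times> (- {0})) (A \<union> E1)"
  proof (rule bij_betw_combine)
    show "bij_betw f (A \<times> {0}) A"
      by (auto simp: bij_betw_def inj_on_def f_def image_iff)
    show "bij_betw f (A \<times> (- {0})) E1"
      using f' by (rule bij_betw_cong[THEN iffD1, rotated]) (auto simp: f_def split: if_splits)
    show "A \<inter> E1 = {}" by (auto simp: A_def)
  qed
  moreover have "A \<times> {0} \<union> A \<times> (- {0}) = ?T" "A \<union> E1 = X"
    using E E12 by (auto simp: A_def)
  ultimately have f: "bij_betw f ?T X" by simp
  have \<tau>A: "\<tau> permutes A"
    by (rule permutes_superset[OF \<tau>]) (use fixes_E E12 in \<open>auto simp: A_def\<close>)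
  note mem = permutes_in_image[OF \<tau>A]
  \<comment> \<open>The integers serve as indices because the shift must be invertible. It is cut
    off outside \<open>A\<close>, whereas \<open>p\<close> and \<open>t\<close> need no such test,
    as \<tau> is trivial there.\<close>
  define s where "s = (\<lambda>(a, k :: int). if a \<in> A then (a, k + 1) else (a, k))"
  define p where "p = (\<lambda>(a, k :: int). if k < 0 then (a, k) else (\<tau> a, k))"
  define t where "t = (\<lambda>(a, k :: int). if k = 0 then (\<tau> a, k) else (a, k))"
  have s: "s permutes ?T"
  proof (rule bij_imp_permutes)
    show "bij_betw s ?T ?T"
      by (rule bij_betw_byWitness[where f' = "\<lambda>(a, k). (a, k - 1)"]) (auto simp: s_def)
  qed (auto simp: s_def split: if_splits)
  have p: "p permutes ?T"
  proof (rule bij_imp_permutes)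
    show "bij_betw p ?T ?T"
      by (rule bij_betw_byWitness[where f' = "\<lambda>(a, k). if k < 0 then (a, k) else (inv' \<tau> a, k)"])
        (auto simp: p_def mem permutes_inverses[OF \<tau>A] permutes_in_image[OF permutes_inv[OF \<tau>A]] split: if_splits)
  qed (use permutes_not_in[OF \<tau>A] in \<open>force simp: p_def split: if_splits\<close>)
  have t: "t permutes ?T"
  proof (rule bij_imp_permutes)
    show "bij_betw t ?T ?T"
      by (rule bij_betw_byWitness[where f' = "\<lambda>(a, k). if k = 0 then (inv' \<tau> a, k) else (a, k)"])
        (auto simp: t_def mem permutes_inverses[OF \<tau>A] permutes_in_image[OF permutes_inv[OF \<tau>A]] split: if_splits)
  qed (use permutes_not_in[OF \<tau>A] in \<open>force simp: t_def split: if_splits\<close>)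
  \<comment> \<open>\<open>p \<circ> s\<close> and \<open>s \<circ> p\<close> differ only at index
    -1: shifting first reaches copy 0, where \<open>p\<close> starts to act, and \<open>t\<close>
    makes up for the difference. Without inverses this is a pointwise check.\<close>
  have comm: "p \<circ> s = t \<circ> s \<circ> p"
    by (auto simp: fun_eq_iff s_def p_def t_def mem permutes_not_in[OF \<tau>A])
  let ?m = "map_permutation ?T f"
  have injf: "inj_on f ?T" and imf: "f ` ?T = X" using f by (auto simp: bij_betw_def)
  have ps: "?m p permutes X" "?m s permutes X"
    using map_permutation_permutes[OF f] p s by auto
  have mt: "?m t = \<tau>"
  proof
    fix x show "?m t x = \<tau> x"
    proof (cases "x \<in> X")
      case True
      then obtain a k where ak: "x = f (a, k)" "a \<in> A" using imf by blast
      show ?thesis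
      proof (cases "k = 0")
        case True
        then show ?thesis using ak mem
          by (simp add: map_permutation_apply[OF injf] t_def) (simp add: f_def)
      next
        case False
        then have "x \<in> E1" using ak f' by (auto simp: f_def bij_betw_def)
        then show ?thesis using ak False fixes_E E12
          by (simp add: map_permutation_apply[OF injf] t_def)
      qed
    next
      case False
      then show ?thesis using \<tau> imf
        by (simp add: map_permutation_def permutes_not_in)
    qed
  qed
  have "?m p \<circ> ?m s = \<tau> \<circ> ?m s \<circ> ?m p"
  proof -
    have "?m p \<circ> ?m s = ?m (t \<circ> (s \<circ> p))"
      by (simp add: map_permutation_compose'[OF injf s, symmetric] comm o_assoc)
    also have "\<dots> = ?m t \<circ> (?m s \<circ> ?m p)"
      using map_permutation_compose'[OF injf permutes_compose[OF p s], of t]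
        map_permutation_compose'[OF injf p, of s] by simp
    finally show ?thesis by (simp add: mt o_assoc)
  qed
  then have "?m p \<circ> ?m s \<circ> inv' (?m p) \<circ> inv' (?m s) = \<tau> \<circ> (?m s \<circ> (?m p \<circ> inv' (?m p)) \<circ> inv' (?m s))"
    by (simp add: o_assoc)
  also have "\<dots> = \<tau>"
    using ps by (simp add: permutes_inv_o)
  finally show ?thesis using that ps by metis
qed

section \<open>Factoring permutations of an infinite set\<close>

text \<open>A half \<open>P\<close> of \<open>X\<close> works if its image leaves a large part of
  the other half \<open>Q\<close> uncovered. Otherwise the image covers a large part of
  \<open>Q\<close>; shrinking \<open>P\<close> to the preimage of half of that part leaves the other
  half free.\<close>

lemma permutation_moves_large_set_off_large_set:
  assumes inf: "infinite X" and \<sigma>: "\<sigma> permutes X"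
  obtains D where "D \<subseteq> X" "D \<approx> X" "X - (D \<union> \<sigma> ` D) \<approx> X"
proof -
  obtain P Q where PQ: "X = P \<union> Q" "P \<inter> Q = {}" "P \<approx> X" "Q \<approx> X"
    using infinite_split[OF inf] .
  have im: "\<sigma> ` X = X" using \<sigma> by (rule permutes_image)
  have "(Q - \<sigma> ` P) \<union> (Q \<inter> \<sigma> ` P) \<approx> X"
    using PQ(4) by (simp add: Un_Diff_Int)
  then consider "Q - \<sigma> ` P \<approx> X" | "Q \<inter> \<sigma> ` P \<approx> X"
    using eqpoll_Un_infiniteD[OF inf] by blast
  then show ?thesis
  proof cases
    case 1
    moreover have "X - (P \<union> \<sigma> ` P) = Q - \<sigma> ` P" using PQ by auto
    ultimately show ?thesis using that[of P] PQ by auto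
  next
    case 2
    then have "infinite (Q \<inter> \<sigma> ` P)" using inf eqpoll_finite_iff by blast
    then obtain Q1 Q2 where Q: "Q \<inter> \<sigma> ` P = Q1 \<union> Q2" "Q1 \<inter> Q2 = {}"
      "Q1 \<approx> Q \<inter> \<sigma> ` P" "Q2 \<approx> Q \<inter> \<sigma> ` P"
      by (rule infinite_split)
    define D where "D = P \<inter> \<sigma> -` Q1"
    have \<sigma>D: "\<sigma> ` D = Q1"
    proof -
      have "Q1 \<subseteq> \<sigma> ` P" using Q(1) by auto
      then show ?thesis by (auto simp: D_def)
    qed
    have "D \<approx> Q1"
      using eqpoll_sym[OF inj_on_image_eqpoll_self[of \<sigma> D]] permutes_inj_on[OF \<sigma>] \<sigma>D by simp
    then have "D \<approx> X" using Q(3) 2 eqpoll_trans by blast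
    moreover have "X - (D \<union> \<sigma> ` D) \<approx> X"
    proof (rule eqpoll_between)
      show "Q2 \<subseteq> X - (D \<union> \<sigma> ` D)" using Q(1,2) PQ(1,2) unfolding \<sigma>D by (auto simp: D_def)
      show "Q2 \<approx> X" using Q(4) 2 eqpoll_trans by blast
    qed auto
    ultimately show ?thesis using that[of D] PQ by (auto simp: D_def)
  qed
qed

text \<open>Let \<rho> agree with \<sigma> on \<open>D\<close> and be trivial on a set
  \<open>E\<close> disjoint from \<open>D\<close> and its image; then
  \<open>inv' \<rho> \<circ> \<sigma>\<close> is trivial on \<open>D\<close>. Any bijection between
  the remaining points completes \<rho>.\<close>

lemma permutation_factors_fix_large_sets:
  assumes inf: "infinite X" and \<sigma>: "\<sigma> permutes X"
  obtains \<rho> \<rho>' E D where "\<rho> permutes X" "\<rho>' permutes X" "\<sigma> = \<rho> \<circ> \<rho>'"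
    "E \<subseteq> X" "E \<approx> X" "\<forall>x\<in>E. \<rho> x = x"
    "D \<subseteq> X" "D \<approx> X" "\<forall>x\<in>D. \<rho>' x = x"
proof -
  obtain D where D: "D \<subseteq> X" "D \<approx> X" "X - (D \<union> \<sigma> ` D) \<approx> X"
    using permutation_moves_large_set_off_large_set[OF assms] .
  have \<sigma>D: "\<sigma> ` D \<subseteq> X" using D(1) permutes_image[OF \<sigma>] by auto
  have "infinite (X - (D \<union> \<sigma> ` D))" using D inf eqpoll_finite_iff by blast
  then obtain E F where EF: "X - (D \<union> \<sigma> ` D) = E \<union> F" "E \<inter> F = {}"
    "E \<approx> X - (D \<union> \<sigma> ` D)" "F \<approx> X - (D \<union> \<sigma> ` D)"
    by (rule infinite_split)
  have E: "E \<approx> X" and F: "F \<approx> X" using EF D(3) eqpoll_trans by blast+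
  \<comment> \<open>\<open>F\<close> is a reserve lying in both complements, which makes them
    equally large. If \<open>E\<close> took up everything outside \<open>D\<close> and its image,
    their sizes could differ, as for a shift.\<close>
  have "X - (D \<union> E) \<approx> X" "X - (\<sigma> ` D \<union> E) \<approx> X"
    using EF by (auto intro!: eqpoll_between[OF _ _ F])
  then have "X - (D \<union> E) \<approx> X - (\<sigma> ` D \<union> E)" by (meson eqpoll_sym eqpoll_trans)
  then obtain h where h: "bij_betw h (X - (D \<union> E)) (X - (\<sigma> ` D \<union> E))"
    by (auto simp: eqpoll_def)
  define \<rho> where "\<rho> = (\<lambda>x. if x \<in> D then \<sigma> x else if x \<in> X - (D \<union> E) then h x else x)"
  have "bij_betw \<rho> (D \<union> E \<union> (X - (D \<union> E))) (\<sigma> ` D \<union> E \<union> (X - (\<sigma> ` D \<union> E)))"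
  proof (intro bij_betw_combine)
    show "bij_betw \<rho> D (\<sigma> ` D)"
      using permutes_inj_on[OF \<sigma>] by (auto simp: bij_betw_def \<rho>_def inj_on_def)
    show "bij_betw \<rho> E E"
      using EF by (auto simp: bij_betw_def \<rho>_def inj_on_def image_iff)
    show "bij_betw \<rho> (X - (D \<union> E)) (X - (\<sigma> ` D \<union> E))"
      using h by (rule bij_betw_cong[THEN iffD1, rotated]) (auto simp: \<rho>_def)
    show "\<sigma> ` D \<inter> E = {}" using EF by auto
  qed auto
  moreover have "D \<union> E \<union> (X - (D \<union> E)) = X" "\<sigma> ` D \<union> E \<union> (X - (\<sigma> ` D \<union> E)) = X"
    using D(1) EF \<sigma>D by auto
  ultimately have \<rho>: "\<rho> permutes X"
    using D(1) EF by (intro bij_imp_permutes) (auto simp: \<rho>_def)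
  show ?thesis
  proof (rule that[of \<rho> "inv' \<rho> \<circ> \<sigma>" E D])
    show "inv' \<rho> \<circ> \<sigma> permutes X" using \<sigma> \<rho> by (simp add: permutes_compose permutes_inv)
    show "\<sigma> = \<rho> \<circ> (inv' \<rho> \<circ> \<sigma>)" using \<rho> by (simp add: o_assoc permutes_inv_o)
    show "E \<subseteq> X" using EF by auto
    show "\<forall>x\<in>D. (inv' \<rho> \<circ> \<sigma>) x = x"
    proof
      fix x assume "x \<in> D"
      then show "(inv' \<rho> \<circ> \<sigma>) x = x"
        using permutes_inverses(2)[OF \<rho>, of x] by (simp add: \<rho>_def)
    qed
    show "\<forall>x\<in>E. \<rho> x = x"
      using EF by (auto simp: \<rho>_def)
  qed (use \<rho> E D in auto)
qed

text \<open>Each of the two factors is a single commutator, so closure under composition suffices.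
  \<open>H\<close> will be the set of all \<open>t\<close> such that \<open>gam X id t\<close> is
  generated by the involutions.\<close>

lemma permutes_infinite_in_commutator_closed:
  assumes "infinite X" "\<sigma> permutes X"
    and comm: "\<And>p s. p permutes X \<Longrightarrow> s permutes X \<Longrightarrow> p \<circ> s \<circ> inv' p \<circ> inv' s \<in> H"
    and comp: "\<And>p q. p \<in> H \<Longrightarrow> q \<in> H \<Longrightarrow> p \<circ> q \<in> H"
  shows "\<sigma> \<in> H"
proof -
  obtain \<rho> \<rho>' E D where *: "\<rho> permutes X" "\<rho>' permutes X" "\<sigma> = \<rho> \<circ> \<rho>'"
    "E \<subseteq> X" "E \<approx> X" "\<forall>x\<in>E. \<rho> x = x"
    "D \<subseteq> X" "D \<approx> X" "\<forall>x\<in>D. \<rho>' x = x"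
    using permutation_factors_fix_large_sets[OF assms(1,2)] .
  have "\<rho> \<in> H"
    by (rule commutator_if_fixes_large_set[OF assms(1) *(1,4,5,6)]) (simp_all add: comm)
  moreover have "\<rho>' \<in> H"
    by (rule commutator_if_fixes_large_set[OF assms(1) *(2,7,8,9)]) (simp_all add: comm)
  ultimately show ?thesis using * comp by blast
qed

section \<open>Even permutations of a finite set\<close>

lemma evenperm_in_commutator_closed:
  assumes "finite X" "\<sigma> permutes X" "evenperm \<sigma>"
    and comm: "\<And>p s. p permutes X \<Longrightarrow> s permutes X \<Longrightarrow> p \<circ> s \<circ> inv' p \<circ> inv' s \<in> H"
    and comp: "\<And>p q. p \<in> H \<Longrightarrow> q \<in> H \<Longrightarrow> p \<circ> q \<in> H"
  shows "\<sigma> \<in> H"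
proof -
  have one: "id \<in> H" using comm[of id id] by simp
  \<comment> \<open>A transposition \<open>(c d)\<close> is a conjugate \<open>g (a b) g\<inverse>\<close>, so \<open>(a b) (c d)\<close> is a commutator.\<close>
  have tt: "transpose a b \<circ> transpose c d \<in> H"
    if ab: "a \<in> X" "b \<in> X" "c \<in> X" "d \<in> X" "a \<noteq> b" "c \<noteq> d" for a b c d
  proof -
    obtain g where g: "g permutes X" "g a = c" "g b = d"
    proof (rule that)
      \<comment> \<open>After \<open>a\<close> has been moved to \<open>c\<close>, the point
        \<open>b\<close> sits at \<open>b'\<close>. As \<open>c\<close> differs from both
        \<open>d\<close> and \<open>b'\<close>, the second transposition brings \<open>b'\<close> to
        \<open>d\<close> without disturbing \<open>c\<close>.\<close>
      define b' where "b' = transpose a c b"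
      show "transpose d b' \<circ> transpose a c permutes X"
        using ab by (intro permutes_compose permutes_swap_id) (auto simp: b'_def transpose_def)
      have "b' \<noteq> c" using ab by (auto simp: b'_def transpose_def)
      then show "(transpose d b' \<circ> transpose a c) a = c"
        using ab by (auto simp: transpose_def)
      show "(transpose d b' \<circ> transpose a c) b = d"
        by (simp add: b'_def)
    qed
    have "g \<circ> transpose a b \<circ> inv' g = transpose c d"
    proof -
      have "g \<circ> transpose a b = transpose c d \<circ> g"
        using g permutes_inj[OF g(1)] by (auto simp: fun_eq_iff transpose_def inj_eq)
      then have "g \<circ> transpose a b \<circ> inv' g = transpose c d \<circ> (g \<circ> inv' g)"
        by (simp add: o_assoc)
      then show ?thesis using g by (simp add: permutes_inv_o)
    qed
    moreover have "transpose a b \<circ> g \<circ> inv' (transpose a b) \<circ> inv' g \<in> H"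
      by (rule comm) (use g that in \<open>auto intro: permutes_swap_id\<close>)
    moreover have "transpose a b \<circ> g \<circ> inv' (transpose a b) \<circ> inv' g
        = transpose a b \<circ> (g \<circ> transpose a b \<circ> inv' g)"
      by (simp add: o_assoc)
    ultimately show ?thesis by simp
  qed
  show ?thesis
  proof (cases "\<exists>a\<in>X. \<exists>b\<in>X. a \<noteq> b")
    case False
    then have "\<sigma> = id" using assms(2)
      by (metis eq_id_iff permutes_in_image permutes_not_in)
    then show ?thesis using one by simp
  next
    case True
    then obtain a b where ab: "a \<in> X" "b \<in> X" "a \<noteq> b" by blast
    \<comment> \<open>Parity alternates along the induction over transpositions. A fixed
      transposition \<open>(a b)\<close> in front makes the odd permutations even, so every step
      multiplies by a pair of transpositions.\<close>
    have "if evenperm \<sigma> then \<sigma> \<in> H else transpose a b \<circ> \<sigma> \<in> H"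
      using assms(2,1)
    proof (induction rule: permutes_induct)
      case id
      then show ?case using one by simp
    next
      case (swap c d p)
      show ?case
      proof (cases "c = d")
        case True
        then show ?thesis using swap by simp
      next
        case False
        have "permutation p" using swap assms(1) permutation_permutes by blast
        then have ev: "evenperm (transpose c d \<circ> p) \<longleftrightarrow> \<not> evenperm p"
          using False by (simp add: evenperm_comp permutation_swap_id evenperm_swap)
        show ?thesis
        proof (cases "evenperm p")
          case True
          then have "(transpose a b \<circ> transpose c d) \<circ> p \<in> H"
            using swap comp tt ab False by simp
          then show ?thesis using ev True by (simp only: o_assoc if_False simp_thms)
        next
          case False
          then have "(transpose c d \<circ> transpose a b) \<circ> (transpose a b \<circ> p) \<in> H"
            using swap comp tt ab \<open>c \<noteq> d\<close> by simp
          moreover have "(transpose c d \<circ> transpose a b) \<circ> (transpose a b \<circ> p) = transpose c d \<circ> p"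
            by (simp add: fun_eq_iff)
          ultimately show ?thesis using ev False by (simp only: simp_thms if_True)
        qed
      qed
    qed
    then show ?thesis using assms(3) by simp
  qed
qed

section \<open>Automorphism groups\<close>

lemma Sym_iff [simp]: "p \<in> Sym X \<longleftrightarrow> p permutes X"
  by (simp add: Sym_def)

lemma
  shows carrier_symmetric_group [simp]: "carrier (symmetric_group X) = Sym X"
    and mult_symmetric_group [simp]: "mult (symmetric_group X) = (\<circ>)"
    and one_symmetric_group [simp]: "one (symmetric_group X) = id"
  by (simp_all add: symmetric_group_def)

lemma group_symmetric_group: "group (symmetric_group X)"
proof (rule groupI)
  fix p assume "p \<in> carrier (symmetric_group X)"
  then show "\<exists>q\<in>carrier (symmetric_group X). q \<otimes>\<^bsub>symmetric_group X\<^esub> p = \<one>\<^bsub>symmetric_group X\<^esub>"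
    by (auto intro!: bexI[of _ "inv' p"] simp: permutes_inv permutes_inv_o)
qed (auto simp: permutes_compose o_assoc)

lemma inv_symmetric_group:
  "p permutes X \<Longrightarrow> m_inv (symmetric_group X) p = inv' p"
  by (rule group.inv_equality[OF group_symmetric_group])
    (auto simp: permutes_inv permutes_inv_o)

lemma
  shows Aut_comp_Aut: "\<alpha> \<in> Aut S m \<Longrightarrow> \<beta> \<in> Aut S m \<Longrightarrow> \<alpha> \<circ> \<beta> \<in> Aut S m"
    and Aut_comp_AntiAut: "\<alpha> \<in> Aut S m \<Longrightarrow> \<beta> \<in> AntiAut S m \<Longrightarrow> \<alpha> \<circ> \<beta> \<in> AntiAut S m"
    and AntiAut_comp_Aut: "\<alpha> \<in> AntiAut S m \<Longrightarrow> \<beta> \<in> Aut S m \<Longrightarrow> \<alpha> \<circ> \<beta> \<in> AntiAut S m"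
    and AntiAut_comp_AntiAut: "\<alpha> \<in> AntiAut S m \<Longrightarrow> \<beta> \<in> AntiAut S m \<Longrightarrow> \<alpha> \<circ> \<beta> \<in> Aut S m"
  by (auto simp: Aut_def AntiAut_def permutes_compose permutes_in_image)

lemma inv_in_Aut:
  assumes "\<alpha> \<in> Aut S m" shows "inv' \<alpha> \<in> Aut S m"
proof -
  have \<alpha>: "\<alpha> permutes S" using assms by (simp add: Aut_def)
  have "inv' \<alpha> (m x y) = m (inv' \<alpha> x) (inv' \<alpha> y)" if "x \<in> S" "y \<in> S" for x y
  proof -
    have "\<alpha> (m (inv' \<alpha> x) (inv' \<alpha> y)) = m x y"
      using assms that
      by (simp add: Aut_def permutes_in_image[OF permutes_inv[OF \<alpha>]] permutes_inverses[OF \<alpha>])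
    then show ?thesis using permutes_inverses(2)[OF \<alpha>] by metis
  qed
  then show ?thesis using permutes_inv[OF \<alpha>] by (simp add: Aut_def)
qed

lemma inv_in_AntiAut:
  assumes "\<alpha> \<in> AntiAut S m" shows "inv' \<alpha> \<in> AntiAut S m"
proof -
  have \<alpha>: "\<alpha> permutes S" using assms by (simp add: AntiAut_def)
  have "inv' \<alpha> (m x y) = m (inv' \<alpha> y) (inv' \<alpha> x)" if "x \<in> S" "y \<in> S" for x y
  proof -
    have "\<alpha> (m (inv' \<alpha> y) (inv' \<alpha> x)) = m x y"
      using assms that
      by (simp add: AntiAut_def permutes_in_image[OF permutes_inv[OF \<alpha>]] permutes_inverses[OF \<alpha>])
    then show ?thesis using permutes_inverses(2)[OF \<alpha>] by metis
  qed
  then show ?thesis using permutes_inv[OF \<alpha>] by (simp add: AntiAut_def)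
qed

lemma AutPM_permutes: "\<alpha> \<in> AutPM S m \<Longrightarrow> \<alpha> permutes S"
  by (auto simp: AutPM_def Aut_def AntiAut_def)

lemma
  shows carrier_AutPM_group [simp]: "carrier (AutPM_group S m) = AutPM S m"
    and mult_AutPM_group [simp]: "mult (AutPM_group S m) = (\<circ>)"
    and one_AutPM_group [simp]: "one (AutPM_group S m) = id"
  by (simp_all add: AutPM_group_def)

lemma group_AutPM_group: "group (AutPM_group S m)"
proof (rule groupI)
  fix \<alpha> assume \<alpha>: "\<alpha> \<in> carrier (AutPM_group S m)"
  have "\<alpha> permutes S" using \<alpha> AutPM_permutes by auto
  moreover have "inv' \<alpha> \<in> AutPM S m"
    using \<alpha> by (auto simp: AutPM_def intro: inv_in_Aut inv_in_AntiAut)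
  ultimately show "\<exists>\<beta>\<in>carrier (AutPM_group S m).
      \<beta> \<otimes>\<^bsub>AutPM_group S m\<^esub> \<alpha> = \<one>\<^bsub>AutPM_group S m\<^esub>"
    by (auto intro!: bexI[of _ "inv' \<alpha>"] simp: permutes_inv_o)
next
  show "\<one>\<^bsub>AutPM_group S m\<^esub> \<in> carrier (AutPM_group S m)"
    by (simp add: AutPM_def Aut_def)
qed (auto simp: o_assoc AutPM_def Aut_comp_Aut Aut_comp_AntiAut AntiAut_comp_Aut
       AntiAut_comp_AntiAut)

lemma
  shows Involutions_subset_InvGen: "Involutions S m \<subseteq> InvGen S m"
    and InvGen_comp: "\<alpha> \<in> InvGen S m \<Longrightarrow> \<beta> \<in> InvGen S m \<Longrightarrow> \<alpha> \<circ> \<beta> \<in> InvGen S m"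
  unfolding InvGen_def
  using generate.incl[of _ "Involutions S m"]
    generate.eng[of \<alpha> "AutPM_group S m" "Involutions S m" \<beta>] by auto

lemma InvGen_subset_AutPM: "InvGen S m \<subseteq> AutPM S m"
  unfolding InvGen_def
  using group.generate_incl[OF group_AutPM_group, of "Involutions S m" S m]
  by (auto simp: Involutions_def AutPM_def)

lemma InvGen_eq_id_if_no_Involutions: "Involutions S m = {} \<Longrightarrow> InvGen S m = {id}"
  unfolding InvGen_def using group.generate_empty[OF group_AutPM_group] by simp

text \<open>Involutions are their own inverses, so inverses of generators add no case to the
  induction.\<close>

lemma InvGen_induct [consumes 1, case_names id incl comp]:
  assumes "\<alpha> \<in> InvGen S m" "P id" "\<And>\<alpha>. \<alpha> \<in> Involutions S m \<Longrightarrow> P \<alpha>"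
    and "\<And>\<alpha> \<beta>. P \<alpha> \<Longrightarrow> P \<beta> \<Longrightarrow> P (\<alpha> \<circ> \<beta>)"
  shows "P \<alpha>"
  using assms(1) unfolding InvGen_def
proof (induction rule: generate.induct)
  case (inv h)
  have "m_inv (AutPM_group S m) h = h"
    by (rule group.inv_equality[OF group_AutPM_group])
      (use inv in \<open>auto simp: Involutions_def AutPM_def\<close>)
  then show ?case using inv assms by simp
qed (simp_all only: one_AutPM_group mult_AutPM_group assms(2-4))

section \<open>Automorphisms of rectangular bands\<close>

text \<open>These four rules are the multiplication of the wreath product: a \<open>del\<close> on
  the left interchanges the two permutations of the right factor.\<close>

lemma gam_comp_gam:
  "\<sigma>' permutes X \<Longrightarrow> \<tau>' permutes X \<Longrightarrow>
    gam X \<sigma> \<tau> \<circ> gam X \<sigma>' \<tau>' = gam X (\<sigma> \<circ> \<sigma>') (\<tau> \<circ> \<tau>')"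
  by (auto simp: gam_def fun_eq_iff permutes_in_image)

lemma gam_comp_del:
  "\<sigma>' permutes X \<Longrightarrow> \<tau>' permutes X \<Longrightarrow>
    gam X \<sigma> \<tau> \<circ> del X \<sigma>' \<tau>' = del X (\<sigma> \<circ> \<sigma>') (\<tau> \<circ> \<tau>')"
  by (auto simp: gam_def del_def fun_eq_iff permutes_in_image)

lemma del_comp_gam:
  "\<sigma>' permutes X \<Longrightarrow> \<tau>' permutes X \<Longrightarrow>
    del X \<sigma> \<tau> \<circ> gam X \<sigma>' \<tau>' = del X (\<sigma> \<circ> \<tau>') (\<tau> \<circ> \<sigma>')"
  by (auto simp: gam_def del_def fun_eq_iff permutes_in_image)

lemma del_comp_del:
  "\<sigma>' permutes X \<Longrightarrow> \<tau>' permutes X \<Longrightarrow>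
    del X \<sigma> \<tau> \<circ> del X \<sigma>' \<tau>' = gam X (\<sigma> \<circ> \<tau>') (\<tau> \<circ> \<sigma>')"
  by (auto simp: gam_def del_def fun_eq_iff permutes_in_image)

lemma gam_id_id: "gam X id id = id"
  by (auto simp: gam_def fun_eq_iff)

lemma gam_permutes:
  assumes "\<sigma> permutes X" "\<tau> permutes X"
  shows "gam X \<sigma> \<tau> permutes X \<times> X"
proof (rule bij_imp_permutes)
  show "bij_betw (gam X \<sigma> \<tau>) (X \<times> X) (X \<times> X)"
    by (rule bij_betw_byWitness[where f' = "gam X (inv' \<sigma>) (inv' \<tau>)"])
      (use assms in \<open>auto simp: gam_def permutes_in_image permutes_inv permutes_inverses\<close>)
qed (auto simp: gam_def split: if_splits)

text \<open>\<open>del X id id\<close> is the coordinate swap. Every other \<open>del\<close> is a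
  \<open>gam\<close> composed with it, so bijectivity has to be checked only here.\<close>

lemma del_id_id_permutes: "del X id id permutes X \<times> X"
  by (rule bij_imp_permutes, rule bij_betw_byWitness[where f' = "del X id id"])
    (auto simp: del_def split: if_splits)

lemma gam_in_Aut:
  "\<sigma> permutes X \<Longrightarrow> \<tau> permutes X \<Longrightarrow> gam X \<sigma> \<tau> \<in> Aut (X \<times> X) rect"
  using gam_permutes by (auto simp: Aut_def gam_def rect_def)

lemma del_in_AntiAut:
  assumes "\<sigma> permutes X" "\<tau> permutes X"
  shows "del X \<sigma> \<tau> \<in> AntiAut (X \<times> X) rect"
proof -
  have "del X id id \<in> AntiAut (X \<times> X) rect"
    using del_id_id_permutes by (auto simp: AntiAut_def del_def rect_def)
  then have "gam X \<sigma> \<tau> \<circ> del X id id \<in> AntiAut (X \<times> X) rect"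
    by (rule Aut_comp_AntiAut[OF gam_in_Aut[OF assms]])
  then show ?thesis by (simp add: gam_comp_del)
qed

text \<open>For a fixed \<open>c\<close>, \<open>(x, y)\<close> is the product of
  \<open>(x, c)\<close> and \<open>(c, y)\<close>. Its image thus takes the first coordinate from
  the image of \<open>(x, c)\<close> and the second from that of \<open>(c, y)\<close>.\<close>

lemma Aut_rect_obtain_gam:
  assumes "\<alpha> \<in> Aut (X \<times> X) rect"
  obtains \<sigma> \<tau> where "\<sigma> permutes X" "\<tau> permutes X" "\<alpha> = gam X \<sigma> \<tau>"
proof (cases "X = {}")
  case True
  then have "\<alpha> = gam X id id" using assms by (simp add: Aut_def gam_id_id)
  then show ?thesis using that permutes_id by blast
next
  case False
  then obtain c where c: "c \<in> X" by blast
  have \<alpha>: "\<alpha> permutes X \<times> X" using assms by (simp add: Aut_def)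
  have hom: "\<alpha> (x, y') = (fst (\<alpha> (x, y)), snd (\<alpha> (x', y')))"
    if "x \<in> X" "y \<in> X" "x' \<in> X" "y' \<in> X" for x y x' y'
  proof -
    have "\<alpha> (rect (x, y) (x', y')) = rect (\<alpha> (x, y)) (\<alpha> (x', y'))"
      using assms that unfolding Aut_def by blast
    then show ?thesis by (simp add: rect_def)
  qed
  have in_X: "fst (\<alpha> (x, y)) \<in> X" "snd (\<alpha> (x, y)) \<in> X" if "x \<in> X" "y \<in> X" for x y
    using permutes_in_image[OF \<alpha>, of "(x, y)"] that by (auto simp: mem_Times_iff)
  have inj: "x = x' \<and> y = y'" if "\<alpha> (x, y) = \<alpha> (x', y')" for x y x' y'
    using permutes_inj[OF \<alpha>] that by (auto dest: injD)
  have surj: "\<exists>x\<in>X. \<exists>y\<in>X. \<alpha> (x, y) = (z, w)" if "z \<in> X" "w \<in> X" for z w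
  proof -
    have "(z, w) \<in> \<alpha> ` (X \<times> X)" using permutes_image[OF \<alpha>] that by simp
    then obtain x y where "x \<in> X" "y \<in> X" "(z, w) = \<alpha> (x, y)" by blast
    then show ?thesis by metis
  qed
  define \<sigma> where "\<sigma> = (\<lambda>x. if x \<in> X then fst (\<alpha> (x, c)) else x)"
  define \<tau> where "\<tau> = (\<lambda>y. if y \<in> X then snd (\<alpha> (c, y)) else y)"
  have eq: "\<alpha> (x, y) = (\<sigma> x, \<tau> y)" if "x \<in> X" "y \<in> X" for x y
    using hom[OF that(1) c c that(2)] that by (simp add: \<sigma>_def \<tau>_def)
  have bij: "bij_betw \<sigma> X X" "bij_betw \<tau> X X"
  proof (safe intro!: bij_betwI')
    fix x y assume "x \<in> X" "y \<in> X"
    then show "\<sigma> x = \<sigma> y \<Longrightarrow> x = y" "\<tau> x = \<tau> y \<Longrightarrow> x = y"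
      using inj[of x c y c] inj[of c x c y] c by (auto simp: eq)
  next
    \<comment> \<open>A preimage of the diagonal point \<open>(y, y)\<close> yields surjectivity of
      \<sigma> and \<tau> at once.\<close>
    fix y assume "y \<in> X"
    then obtain x z where "x \<in> X" "z \<in> X" "\<alpha> (x, z) = (y, y)" using surj by blast
    then have "y = \<sigma> x" "y = \<tau> z" "x \<in> X" "z \<in> X" by (simp_all add: eq)
    then show "\<exists>x\<in>X. y = \<sigma> x" "\<exists>x\<in>X. y = \<tau> x" by blast+
  qed (use c in_X in \<open>auto simp: \<sigma>_def \<tau>_def\<close>)
  show ?thesis
  proof
    show "\<sigma> permutes X" "\<tau> permutes X"
      using bij by (auto intro!: bij_imp_permutes simp: \<sigma>_def \<tau>_def)
    show "\<alpha> = gam X \<sigma> \<tau>"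
      using eq permutes_not_in[OF \<alpha>] by (auto simp: gam_def fun_eq_iff)
  qed
qed

lemma Aut_rect: "Aut (X \<times> X) rect = {gam X \<sigma> \<tau> | \<sigma> \<tau>. \<sigma> \<in> Sym X \<and> \<tau> \<in> Sym X}"
  by (auto intro: gam_in_Aut elim!: Aut_rect_obtain_gam)

lemma AntiAut_rect: "AntiAut (X \<times> X) rect = {del X \<sigma> \<tau> | \<sigma> \<tau>. \<sigma> \<in> Sym X \<and> \<tau> \<in> Sym X}"
proof (intro equalityI subsetI)
  fix \<alpha> assume "\<alpha> \<in> AntiAut (X \<times> X) rect"
  then have "\<alpha> \<circ> del X id id \<in> Aut (X \<times> X) rect"
    by (rule AntiAut_comp_AntiAut) (simp add: del_in_AntiAut)
  then obtain \<sigma> \<tau> where *: "\<sigma> permutes X" "\<tau> permutes X" "\<alpha> \<circ> del X id id = gam X \<sigma> \<tau>"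
    by (rule Aut_rect_obtain_gam)
  \<comment> \<open>The coordinate swap is its own inverse, so \<alpha> is recovered from the
    automorphism just described.\<close>
  have "\<alpha> = \<alpha> \<circ> (del X id id \<circ> del X id id)"
    by (simp add: del_comp_del gam_id_id)
  also have "\<dots> = del X \<sigma> \<tau>"
    unfolding o_assoc *(3) by (simp add: gam_comp_del)
  finally show "\<alpha> \<in> {del X \<sigma> \<tau> | \<sigma> \<tau>. \<sigma> \<in> Sym X \<and> \<tau> \<in> Sym X}" using * by auto
qed (auto intro: del_in_AntiAut)

lemma AutPM_rect:
  "AutPM (X \<times> X) rect =
    {gam X \<sigma> \<tau> | \<sigma> \<tau>. \<sigma> \<in> Sym X \<and> \<tau> \<in> Sym X} \<union>
    {del X \<sigma> \<tau> | \<sigma> \<tau>. \<sigma> \<in> Sym X \<and> \<tau> \<in> Sym X}"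
  by (simp add: AutPM_def Aut_rect AntiAut_rect)

section \<open>Comparing the sizes of the two factors\<close>

text \<open>An anti-automorphism makes \<open>snd (\<alpha> (x, y))\<close> depend on
  \<open>x\<close> alone, which gives a bijection from \<open>X\<close> onto \<open>Y\<close>. The
  points \<open>a\<close> and \<open>b\<close> exclude the empty band, whose identity is an
  anti-automorphism whatever the other factor is.\<close>

lemma AntiAut_rect_imp_eqpoll:
  assumes "\<alpha> \<in> AntiAut (X \<times> Y) rect" and c: "a \<in> X" "b \<in> Y"
  shows "X \<approx> Y"
proof -
  have \<alpha>: "\<alpha> permutes X \<times> Y" using assms by (simp add: AntiAut_def)
  have hom: "\<alpha> (x, y') = (fst (\<alpha> (x', y')), snd (\<alpha> (x, y)))"
    if "x \<in> X" "y \<in> Y" "x' \<in> X" "y' \<in> Y" for x y x' y'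
  proof -
    have "\<alpha> (rect (x, y) (x', y')) = rect (\<alpha> (x', y')) (\<alpha> (x, y))"
      using assms that unfolding AntiAut_def by blast
    then show ?thesis by (simp add: rect_def)
  qed
  have "bij_betw (\<lambda>x. snd (\<alpha> (x, b))) X Y"
  proof (rule bij_betwI')
    fix x x' assume "x \<in> X" "x' \<in> X"
    then have "\<alpha> (x, b) = \<alpha> (x', b)" if "snd (\<alpha> (x, b)) = snd (\<alpha> (x', b))"
      using hom[of x b a b] hom[of x' b a b] c that by simp
    then show "(snd (\<alpha> (x, b)) = snd (\<alpha> (x', b))) = (x = x')"
      using permutes_inj[OF \<alpha>] by (auto dest: injD)
  next
    fix x assume "x \<in> X" then show "snd (\<alpha> (x, b)) \<in> Y"
      using permutes_in_image[OF \<alpha>, of "(x, b)"] c by (auto simp: mem_Times_iff)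
  next
    fix y assume "y \<in> Y"
    then have "(a, y) \<in> \<alpha> ` (X \<times> Y)" using permutes_image[OF \<alpha>] c by simp
    then obtain x y' where x: "x \<in> X" "y' \<in> Y" "(a, y) = \<alpha> (x, y')" by blast
    then have "y = snd (\<alpha> (x, b))"
      using hom[of x b x y'] c by (metis snd_conv)
    then show "\<exists>x\<in>X. y = snd (\<alpha> (x, b))" using x(1) by blast
  qed
  then show ?thesis by (auto simp: eqpoll_def)
qed

text \<open>Relabelling the second coordinate respects \<open>rect\<close>, which never mixes the
  coordinates; this justifies taking \<open>Y\<close> to be \<open>X\<close>.\<close>

lemma eqpoll_imp_semigroup_isomorphic_rect:
  assumes "X \<approx> Y"
  shows "semigroup_isomorphic (X \<times> Y) rect (X \<times> X) rect"
proof -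
  obtain f where f: "bij_betw f Y X" using assms eqpoll_sym by (auto simp: eqpoll_def)
  have "bij_betw (map_prod id f) (X \<times> Y) (X \<times> X)"
    by (rule bij_betw_map_prod) (use f in auto)
  then show ?thesis unfolding semigroup_isomorphic_def
    by (rule_tac exI[of _ "map_prod id f"]) (simp add: rect_def)
qed

section \<open>Uniqueness of the parameters and the involutions\<close>

lemma gam_eq_iff:
  assumes "\<sigma> permutes X" "\<tau> permutes X" "\<sigma>' permutes X" "\<tau>' permutes X"
  shows "gam X \<sigma> \<tau> = gam X \<sigma>' \<tau>' \<longleftrightarrow> \<sigma> = \<sigma>' \<and> \<tau> = \<tau>'"
proof safe
  assume eq: "gam X \<sigma> \<tau> = gam X \<sigma>' \<tau>'"
  have "\<sigma> x = \<sigma>' x \<and> \<tau> x = \<tau>' x" if "x \<in> X" for x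
    using fun_cong[OF eq, of "(x, x)"] that by (simp add: gam_def)
  then show "\<sigma> = \<sigma>'" "\<tau> = \<tau>'"
    using assms by (auto simp: fun_eq_iff) (metis permutes_not_in)+
qed

lemma del_eq_iff:
  assumes "\<sigma> permutes X" "\<tau> permutes X" "\<sigma>' permutes X" "\<tau>' permutes X"
  shows "del X \<sigma> \<tau> = del X \<sigma>' \<tau>' \<longleftrightarrow> \<sigma> = \<sigma>' \<and> \<tau> = \<tau>'"
proof
  assume "del X \<sigma> \<tau> = del X \<sigma>' \<tau>'"
  then have "del X \<sigma> \<tau> \<circ> del X id id = del X \<sigma>' \<tau>' \<circ> del X id id" by simp
  then show "\<sigma> = \<sigma>' \<and> \<tau> = \<tau>'"
    using assms by (simp add: del_comp_del gam_eq_iff)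
qed simp

text \<open>A \<open>gam\<close> gives \<open>(x, x)\<close> and \<open>(x, y)\<close> the same
  first coordinate; a \<open>del\<close> doing so would identify \<open>x\<close> and
  \<open>y\<close>. On a one-point set the two families coincide.\<close>

lemma gam_neq_del:
  assumes "x \<in> X" "y \<in> X" "x \<noteq> y" "\<sigma>' permutes X"
  shows "gam X \<sigma> \<tau> \<noteq> del X \<sigma>' \<tau>'"
proof
  assume eq: "gam X \<sigma> \<tau> = del X \<sigma>' \<tau>'"
  have "\<sigma>' x = \<sigma>' y"
    using fun_cong[OF eq, of "(x, x)"] fun_cong[OF eq, of "(x, y)"] assms
    by (simp add: gam_def del_def)
  then show False using assms permutes_inj by (metis injD)
qed

text \<open>The square of \<open>del X \<sigma> \<tau>\<close> is
  \<open>gam X (\<sigma> \<circ> \<tau>) (\<tau> \<circ> \<sigma>)\<close>, which is the identity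
  exactly for mutually inverse permutations.\<close>

lemma Involutions_rect:
  assumes "x \<in> X" "y \<in> X" "x \<noteq> y"
  shows "Involutions (X \<times> X) rect = {del X \<sigma> (inv' \<sigma>) | \<sigma>. \<sigma> \<in> Sym X}"
proof (intro equalityI subsetI)
  fix \<alpha> assume "\<alpha> \<in> Involutions (X \<times> X) rect"
  then obtain \<sigma> \<tau> where *: "\<sigma> permutes X" "\<tau> permutes X" "\<alpha> = del X \<sigma> \<tau>" and
    "\<alpha> \<circ> \<alpha> = id"
    by (auto simp: Involutions_def AntiAut_rect)
  then have "gam X (\<sigma> \<circ> \<tau>) (\<tau> \<circ> \<sigma>) = gam X id id"
    by (simp add: del_comp_del gam_id_id)
  then have "\<sigma> \<circ> \<tau> = id" "\<tau> \<circ> \<sigma> = id"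
    using * by (auto simp: gam_eq_iff permutes_compose)
  then have "inv' \<sigma> = \<tau>" by (simp add: inv_unique_comp)
  then show "\<alpha> \<in> {del X \<sigma> (inv' \<sigma>) | \<sigma>. \<sigma> \<in> Sym X}" using * by auto
next
  fix \<alpha> assume "\<alpha> \<in> {del X \<sigma> (inv' \<sigma>) | \<sigma>. \<sigma> \<in> Sym X}"
  then obtain \<sigma> where *: "\<sigma> permutes X" "\<alpha> = del X \<sigma> (inv' \<sigma>)" by auto
  have "gam X id id \<noteq> \<alpha>" using * assms gam_neq_del by metis
  then show "\<alpha> \<in> Involutions (X \<times> X) rect"
    using * permutes_inv[OF *(1)]
    by (auto simp: Involutions_def del_in_AntiAut del_comp_del permutes_inv_o gam_id_id)
qed

section \<open>The group generated by the involutions\<close>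

lemma gam_inv_in_InvGen:
  assumes "x \<in> X" "y \<in> X" "x \<noteq> y" and \<sigma>: "\<sigma> permutes X"
  shows "gam X \<sigma> (inv' \<sigma>) \<in> InvGen (X \<times> X) rect"
proof -
  have "del X \<rho> (inv' \<rho>) \<in> InvGen (X \<times> X) rect" if "\<rho> permutes X" for \<rho>
    using Involutions_subset_InvGen that by (fastforce simp: Involutions_rect[OF assms(1-3)])
  from InvGen_comp[OF this[OF \<sigma>] this[OF permutes_id]] show ?thesis
    by (simp add: del_comp_del)
qed

text \<open>Multiplying the elements \<open>gam X \<sigma> (inv' \<sigma>)\<close> for \<open>\<sigma>\<close> equal to \<open>p\<inverse>\<close>, \<open>s\<inverse>\<close> and \<open>s p\<close> cancels
  the first coordinate.\<close>

lemma gam_id_commutator_in_InvGen: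
  assumes "x \<in> X" "y \<in> X" "x \<noteq> y" and p: "p permutes X" and s: "s permutes X"
  shows "gam X id (p \<circ> s \<circ> inv' p \<circ> inv' s) \<in> InvGen (X \<times> X) rect"
proof -
  have g: "gam X \<sigma> (inv' \<sigma>) \<in> InvGen (X \<times> X) rect" if "\<sigma> permutes X" for \<sigma>
    using assms(1-3) that by (rule gam_inv_in_InvGen)
  note perms = p s permutes_inv[OF p] permutes_inv[OF s] permutes_compose
  have "gam X (inv' p) p \<in> InvGen (X \<times> X) rect" "gam X (inv' s) s \<in> InvGen (X \<times> X) rect"
    using g[OF permutes_inv[OF p]] g[OF permutes_inv[OF s]]
    by (simp_all only: permutes_inv_inv[OF p] permutes_inv_inv[OF s])
  then have "gam X (inv' p) p \<circ> gam X (inv' s) s \<circ> gam X (s \<circ> p) (inv' (s \<circ> p))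
      \<in> InvGen (X \<times> X) rect"
    by (intro InvGen_comp g permutes_compose[OF p s])
  also have "inv' (s \<circ> p) = inv' p \<circ> inv' s"
    using p s by (simp add: o_inv_distrib permutes_bij)
  also have "gam X (inv' p) p \<circ> gam X (inv' s) s \<circ> gam X (s \<circ> p) (inv' p \<circ> inv' s)
      = gam X (inv' p \<circ> (inv' s \<circ> s) \<circ> p) (p \<circ> s \<circ> inv' p \<circ> inv' s)"
    by (simp add: gam_comp_gam perms o_assoc)
  also have "inv' p \<circ> (inv' s \<circ> s) \<circ> p = id"
    using p s by (simp add: permutes_inv_o)
  finally show ?thesis .
qed

text \<open>The factorisation \<open>gam X \<sigma> \<tau> = gam X \<sigma> (inv' \<sigma>) \<circ>
  gam X id (\<sigma> \<circ> \<tau>)\<close> has its first factor in the group; the swap, itself an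
  involution, then turns \<open>gam\<close> into \<open>del\<close>.\<close>

lemma gam_del_in_InvGen:
  assumes "x \<in> X" "y \<in> X" "x \<noteq> y" and \<sigma>: "\<sigma> permutes X" and \<tau>: "\<tau> permutes X"
    and "gam X id (\<sigma> \<circ> \<tau>) \<in> InvGen (X \<times> X) rect"
  shows "gam X \<sigma> \<tau> \<in> InvGen (X \<times> X) rect" "del X \<sigma> \<tau> \<in> InvGen (X \<times> X) rect"
proof -
  have "gam X \<sigma> (inv' \<sigma>) \<circ> gam X id (\<sigma> \<circ> \<tau>) = gam X \<sigma> (inv' \<sigma> \<circ> \<sigma> \<circ> \<tau>)"
    using \<sigma> \<tau> by (simp add: gam_comp_gam permutes_compose o_assoc)
  then have "gam X \<sigma> (inv' \<sigma>) \<circ> gam X id (\<sigma> \<circ> \<tau>) = gam X \<sigma> \<tau>"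
    using \<sigma> by (simp add: permutes_inv_o)
  then show g: "gam X \<sigma> \<tau> \<in> InvGen (X \<times> X) rect"
    using InvGen_comp[OF gam_inv_in_InvGen[OF assms(1-4)] assms(6)] by simp
  have "del X id id \<in> Involutions (X \<times> X) rect"
    unfolding Involutions_rect[OF assms(1-3)] by (auto intro!: exI[of _ id])
  then have "gam X \<sigma> \<tau> \<circ> del X id id \<in> InvGen (X \<times> X) rect"
    using g InvGen_comp Involutions_subset_InvGen by blast
  then show "del X \<sigma> \<tau> \<in> InvGen (X \<times> X) rect"
    by (simp add: gam_comp_del)
qed

lemma gam_id_comp_in_InvGen:
  assumes "p permutes X" "q permutes X"
    "gam X id p \<in> InvGen (X \<times> X) rect" "gam X id q \<in> InvGen (X \<times> X) rect"
  shows "gam X id (p \<circ> q) \<in> InvGen (X \<times> X) rect"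
  using InvGen_comp[OF assms(3,4)] assms by (simp add: gam_comp_gam)

lemma InvGen_rect_infinite:
  assumes "infinite X"
  shows "InvGen (X \<times> X) rect = AutPM (X \<times> X) rect"
proof (rule antisym[OF InvGen_subset_AutPM])
  obtain x y where xy: "x \<in> X" "y \<in> X" "x \<noteq> y"
    using assms by (rule infinite_obtain_two)
  let ?H = "{\<tau>. \<tau> permutes X \<and> gam X id \<tau> \<in> InvGen (X \<times> X) rect}"
  have H: "\<sigma> \<in> ?H" if "\<sigma> permutes X" for \<sigma>
    using assms that
    by (rule permutes_infinite_in_commutator_closed)
      (auto intro: gam_id_comp_in_InvGen gam_id_commutator_in_InvGen[OF xy] permutes_compose
        permutes_inv)
  show "AutPM (X \<times> X) rect \<subseteq> InvGen (X \<times> X) rect"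
  proof
    fix \<alpha> assume "\<alpha> \<in> AutPM (X \<times> X) rect"
    then obtain \<sigma> \<tau> where perm: "\<sigma> permutes X" "\<tau> permutes X"
      and \<alpha>: "\<alpha> = gam X \<sigma> \<tau> \<or> \<alpha> = del X \<sigma> \<tau>"
      by (auto simp: AutPM_rect)
    have "gam X id (\<sigma> \<circ> \<tau>) \<in> InvGen (X \<times> X) rect"
      using H[OF permutes_compose[OF perm(2,1)]] by simp
    then show "\<alpha> \<in> InvGen (X \<times> X) rect"
      using gam_del_in_InvGen[OF xy perm] \<alpha> by blast
  qed
qed

section \<open>Parity\<close>

lemma evenperm_comp_permutes:
  "finite X \<Longrightarrow> \<sigma> permutes X \<Longrightarrow> \<tau> permutes X \<Longrightarrow>
    evenperm (\<sigma> \<circ> \<tau>) \<longleftrightarrow> (evenperm \<sigma> \<longleftrightarrow> evenperm \<tau>)"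
  by (meson evenperm_comp permutes_imp_permutation)

lemma evenperm_inv_permutes:
  "finite X \<Longrightarrow> \<sigma> permutes X \<Longrightarrow> evenperm (inv' \<sigma>) \<longleftrightarrow> evenperm \<sigma>"
  by (meson evenperm_inv permutes_imp_permutation)

lemma Alt_iff: "\<sigma> \<in> Alt X \<longleftrightarrow> \<sigma> permutes X \<and> evenperm \<sigma>"
  by (simp add: Alt_def)

text \<open>Parity is multiplicative, so an even product means equal parities; in this form closure
  under products, inverses and interchange is evident.\<close>

lemma EvenPairs_iff:
  "finite X \<Longrightarrow> (\<sigma>, \<tau>) \<in> EvenPairs X \<longleftrightarrow>
    \<sigma> permutes X \<and> \<tau> permutes X \<and> (evenperm \<sigma> \<longleftrightarrow> evenperm \<tau>)"
  by (auto simp: EvenPairs_def Alt_iff evenperm_comp_permutes permutes_compose)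

lemma EvenPairs_comp:
  "finite X \<Longrightarrow> (\<sigma>, \<tau>) \<in> EvenPairs X \<Longrightarrow> (\<sigma>', \<tau>') \<in> EvenPairs X \<Longrightarrow>
    (\<sigma> \<circ> \<sigma>', \<tau> \<circ> \<tau>') \<in> EvenPairs X"
  by (auto simp: EvenPairs_iff evenperm_comp_permutes permutes_compose)

lemma EvenPairs_swap:
  "finite X \<Longrightarrow> (\<sigma>, \<tau>) \<in> EvenPairs X \<Longrightarrow> (\<tau>, \<sigma>) \<in> EvenPairs X"
  by (auto simp: EvenPairs_iff)

lemma InvGen_rect_finite:
  assumes fin: "finite X"
  shows "InvGen (X \<times> X) rect =
      {gam X \<sigma> \<tau> | \<sigma> \<tau>. (\<sigma>, \<tau>) \<in> EvenPairs X} \<union> {del X \<sigma> \<tau> | \<sigma> \<tau>. (\<sigma>, \<tau>) \<in> EvenPairs X}"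
    (is "_ = ?R")
proof (cases "\<exists>x\<in>X. \<exists>y\<in>X. x \<noteq> y")
  \<comment> \<open>With at most one point the swap is the identity, so there is no involution, and
    the right-hand side collapses to the identity too.\<close>
  case False
  then have id: "\<sigma> permutes X \<longleftrightarrow> \<sigma> = id" for \<sigma>
    by (metis eq_id_iff permutes_id permutes_in_image permutes_not_in)
  have del: "del X id id = id"
    using False by (auto simp: del_def fun_eq_iff)
  have "Involutions (X \<times> X) rect = {}"
    by (auto simp: Involutions_def AntiAut_rect id del)
  moreover have "(\<sigma>, \<tau>) \<in> EvenPairs X \<longleftrightarrow> \<sigma> = id \<and> \<tau> = id" for \<sigma> \<tau>
    by (auto simp: EvenPairs_iff[OF fin] id)
  ultimately show ?thesis
    by (simp add: InvGen_eq_id_if_no_Involutions del gam_id_id)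
next
  case True
  then obtain x y where xy: "x \<in> X" "y \<in> X" "x \<noteq> y" by blast
  show ?thesis
  proof (intro equalityI subsetI)
    fix \<alpha> assume "\<alpha> \<in> InvGen (X \<times> X) rect"
    then show "\<alpha> \<in> ?R"
    proof (induction rule: InvGen_induct)
      case id
      have "(id, id) \<in> EvenPairs X" by (simp add: EvenPairs_iff[OF fin])
      then show ?case using gam_id_id by (metis (mono_tags, lifting) UnI1 mem_Collect_eq)
    next
      case (incl \<alpha>)
      then obtain \<sigma> where *: "\<sigma> permutes X" "\<alpha> = del X \<sigma> (inv' \<sigma>)"
        by (auto simp: Involutions_rect[OF xy])
      then have "(\<sigma>, inv' \<sigma>) \<in> EvenPairs X"
        by (simp add: EvenPairs_iff[OF fin] permutes_inv evenperm_inv_permutes[OF fin])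
      then show ?case using * by blast
    next
      case (comp \<alpha> \<beta>)
      have perm: "\<sigma> permutes X \<and> \<tau> permutes X" if "(\<sigma>, \<tau>) \<in> EvenPairs X" for \<sigma> \<tau>
        using that by (simp add: EvenPairs_iff[OF fin])
      obtain \<sigma> \<tau> where \<alpha>: "(\<sigma>, \<tau>) \<in> EvenPairs X" "\<alpha> = gam X \<sigma> \<tau> \<or> \<alpha> = del X \<sigma> \<tau>"
        using comp by blast
      obtain \<sigma>' \<tau>' where \<beta>: "(\<sigma>', \<tau>') \<in> EvenPairs X" "\<beta> = gam X \<sigma>' \<tau>' \<or> \<beta> = del X \<sigma>' \<tau>'"
        using comp by blast
      have "\<alpha> \<circ> \<beta> \<in> {gam X (\<sigma> \<circ> \<sigma>') (\<tau> \<circ> \<tau>'), del X (\<sigma> \<circ> \<sigma>') (\<tau> \<circ> \<tau>'),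
          gam X (\<sigma> \<circ> \<tau>') (\<tau> \<circ> \<sigma>'), del X (\<sigma> \<circ> \<tau>') (\<tau> \<circ> \<sigma>')}"
        using \<alpha>(2) \<beta>(2) perm[OF \<beta>(1)]
        by (auto simp: gam_comp_gam gam_comp_del del_comp_gam del_comp_del)
      then show ?case
        using EvenPairs_comp[OF fin \<alpha>(1) \<beta>(1)]
          EvenPairs_comp[OF fin \<alpha>(1) EvenPairs_swap[OF fin \<beta>(1)]] by blast
    qed
  next
    fix \<alpha> assume "\<alpha> \<in> ?R"
    then obtain \<sigma> \<tau> where *: "(\<sigma>, \<tau>) \<in> EvenPairs X" "\<alpha> = gam X \<sigma> \<tau> \<or> \<alpha> = del X \<sigma> \<tau>"
      by blast
    then have perm: "\<sigma> permutes X" "\<tau> permutes X" and ev: "evenperm (\<sigma> \<circ> \<tau>)"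
      by (auto simp: EvenPairs_iff[OF fin] evenperm_comp_permutes[OF fin])
    let ?H = "{\<tau>. \<tau> permutes X \<and> gam X id \<tau> \<in> InvGen (X \<times> X) rect}"
    have "\<sigma> \<circ> \<tau> \<in> ?H"
      using fin permutes_compose[OF perm(2,1)] ev
      by (rule evenperm_in_commutator_closed)
        (auto intro: gam_id_comp_in_InvGen gam_id_commutator_in_InvGen[OF xy] permutes_compose
          permutes_inv)
    then show "\<alpha> \<in> InvGen (X \<times> X) rect"
      using gam_del_in_InvGen[OF xy perm] *(2) by blast
  qed
qed

section \<open>Wreath and semidirect products\<close>

text \<open>The explicit maps run from the product to the group of maps, opposite to the claims.
  Inverting them through closure of the source spares checking the group laws of
  \<open>semidirect\<close>.\<close>

lemma iso_imp_is_iso_sym: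
  assumes h: "h \<in> iso G H"
    and closed: "\<And>x y. x \<in> carrier G \<Longrightarrow> y \<in> carrier G \<Longrightarrow> x \<otimes>\<^bsub>G\<^esub> y \<in> carrier G"
  shows "H \<cong> G"
proof -
  let ?g = "inv_into (carrier G) h"
  have bij: "bij_betw h (carrier G) (carrier H)"
    and hom: "\<And>x y. x \<in> carrier G \<Longrightarrow> y \<in> carrier G \<Longrightarrow> h (x \<otimes>\<^bsub>G\<^esub> y) = h x \<otimes>\<^bsub>H\<^esub> h y"
    using h by (auto simp: iso_def hom_def)
  have bij': "bij_betw ?g (carrier H) (carrier G)" using bij by (rule bij_betw_inv_into)
  have "?g (u \<otimes>\<^bsub>H\<^esub> v) = ?g u \<otimes>\<^bsub>G\<^esub> ?g v" if uv: "u \<in> carrier H" "v \<in> carrier H" for u v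
  proof -
    have g: "?g u \<in> carrier G" "?g v \<in> carrier G"
      using uv bij' by (auto simp: bij_betw_def)
    have "h (?g u \<otimes>\<^bsub>G\<^esub> ?g v) = u \<otimes>\<^bsub>H\<^esub> v"
      using hom[OF g] bij_betw_inv_into_right[OF bij] uv by simp
    then show ?thesis
      using bij_betw_inv_into_left[OF bij closed[OF g]] by simp
  qed
  then have "?g \<in> iso H G"
    using bij' by (auto simp: iso_def hom_def bij_betw_def)
  then show ?thesis by (auto simp: is_iso_def)
qed

lemma Aut_group_rect_iso:
  "Aut_group (X \<times> X) rect \<cong> symmetric_group X \<times>\<times> symmetric_group X"
proof (rule iso_imp_is_iso_sym)
  show "(\<lambda>(\<sigma>, \<tau>). gam X \<sigma> \<tau>) \<in>
      iso (symmetric_group X \<times>\<times> symmetric_group X) (Aut_group (X \<times> X) rect)"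
    by (auto simp: iso_def hom_def bij_betw_def inj_on_def Aut_group_def Aut_rect gam_eq_iff
        gam_comp_gam image_iff) blast+
qed (auto simp: permutes_compose)

text \<open>The parameter \<open>K\<close> covers both uses: all pairs for the wreath product and
  the pairs of equal parity for the finite case. Closure under interchange lets the swap act on
  \<open>K\<close>.\<close>

lemma gam_del_group_iso_semidirect:
  assumes "x \<in> X" "y \<in> X" "x \<noteq> y" and K: "K \<subseteq> Sym X \<times> Sym X"
    and comp: "\<And>\<sigma> \<tau> \<sigma>' \<tau>'. (\<sigma>, \<tau>) \<in> K \<Longrightarrow> (\<sigma>', \<tau>') \<in> K \<Longrightarrow> (\<sigma> \<circ> \<sigma>', \<tau> \<circ> \<tau>') \<in> K"
    and swap: "\<And>\<sigma> \<tau>. (\<sigma>, \<tau>) \<in> K \<Longrightarrow> (\<tau>, \<sigma>) \<in> K"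
    and C: "C = {gam X \<sigma> \<tau> | \<sigma> \<tau>. (\<sigma>, \<tau>) \<in> K} \<union> {del X \<sigma> \<tau> | \<sigma> \<tau>. (\<sigma>, \<tau>) \<in> K}"
  shows "(AutPM_group (X \<times> X) rect)\<lparr>carrier := C\<rparr> \<cong>
    semidirect ((symmetric_group X \<times>\<times> symmetric_group X)\<lparr>carrier := K\<rparr>) Z2 swap_action"
    (is "?A \<cong> ?S")
proof (rule iso_imp_is_iso_sym)
  have carrier_S: "carrier ?S = K \<times> {0, 1}"
    by (auto simp: semidirect_def carrier_integer_mod_group)
  have mult_S: "((\<sigma>, \<tau>), k) \<otimes>\<^bsub>?S\<^esub> ((\<sigma>', \<tau>'), l) =
      (if k = 0 then ((\<sigma> \<circ> \<sigma>', \<tau> \<circ> \<tau>'), (k + l) mod 2) else ((\<sigma> \<circ> \<tau>', \<tau> \<circ> \<sigma>'), (k + l) mod 2))"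
    for \<sigma> \<tau> \<sigma>' \<tau>' k l
    by (simp add: semidirect_def swap_action_def DirProd_def)
  have perm: "\<sigma> permutes X" "\<tau> permutes X" if "(\<sigma>, \<tau>) \<in> K" for \<sigma> \<tau> using K that by auto
  \<comment> \<open>The \<open>Z2\<close> component counts the coordinate swaps applied first:
    \<open>del X \<sigma> \<tau>\<close> is \<open>gam X \<sigma> \<tau>\<close> after one
    swap.\<close>
  let ?h = "\<lambda>((\<sigma>, \<tau>), k :: int). if k = 0 then gam X \<sigma> \<tau> else del X \<sigma> \<tau>"
  have carrier_A: "carrier ?A = C" and mult_A: "mult ?A = (\<circ>)" by simp_all
  have image: "?h ` (K \<times> {0, 1}) = C"
  proof (intro equalityI subsetI)
    fix q assume "q \<in> ?h ` (K \<times> {0, 1})"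
    then show "q \<in> C" by (auto simp: C)
  next
    fix q assume "q \<in> C"
    then obtain \<sigma> \<tau> where "(\<sigma>, \<tau>) \<in> K" "q = gam X \<sigma> \<tau> \<or> q = del X \<sigma> \<tau>"
      by (auto simp: C)
    then have "q \<in> {?h ((\<sigma>, \<tau>), 0), ?h ((\<sigma>, \<tau>), 1)}" "((\<sigma>, \<tau>), 0) \<in> K \<times> {0, 1 :: int}"
      "((\<sigma>, \<tau>), 1) \<in> K \<times> {0, 1 :: int}"
      by auto
    then show "q \<in> ?h ` (K \<times> {0, 1})" by blast
  qed
  have inj: "inj_on ?h (K \<times> {0, 1})"
    using gam_neq_del[OF assms(1-3)]
    by (auto simp: inj_on_def perm gam_eq_iff del_eq_iff dest: perm) (metis perm)+
  have hom: "?h (a \<otimes>\<^bsub>?S\<^esub> b) = ?h a \<circ> ?h b" if ab: "a \<in> K \<times> {0, 1}" "b \<in> K \<times> {0, 1}" for a b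
  proof -
    obtain \<sigma> \<tau> k \<sigma>' \<tau>' l where "a = ((\<sigma>, \<tau>), k)" "b = ((\<sigma>', \<tau>'), l)" "k = 0 \<or> k = 1"
      "l = 0 \<or> l = 1" "(\<sigma>', \<tau>') \<in> K"
      using ab by auto
    then show ?thesis using perm
      by (auto simp: mult_S gam_comp_gam gam_comp_del del_comp_gam del_comp_del)
  qed
  show "?h \<in> iso ?S ?A"
  proof (intro isoI homI)
    show "?h a \<in> carrier ?A" if "a \<in> carrier ?S" for a
      using that image unfolding carrier_S carrier_A by blast
    show "?h (a \<otimes>\<^bsub>?S\<^esub> b) = ?h a \<otimes>\<^bsub>?A\<^esub> ?h b"
      if "a \<in> carrier ?S" "b \<in> carrier ?S" for a b
      using that unfolding carrier_S mult_A by (rule hom)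
    show "bij_betw ?h (carrier ?S) (carrier ?A)"
      unfolding carrier_S carrier_A bij_betw_def using inj image by blast
  qed
  fix a b assume "a \<in> carrier ?S" "b \<in> carrier ?S"
  then obtain \<sigma> \<tau> k \<sigma>' \<tau>' l where "a = ((\<sigma>, \<tau>), k)" "b = ((\<sigma>', \<tau>'), l)" "k = 0 \<or> k = 1"
      "l = 0 \<or> l = 1" "(\<sigma>, \<tau>) \<in> K" "(\<sigma>', \<tau>') \<in> K"
    unfolding carrier_S by auto
  then show "a \<otimes>\<^bsub>?S\<^esub> b \<in> carrier ?S"
    unfolding carrier_S using comp swap by (auto simp: mult_S)
qed

lemma AutPM_group_rect_iso_wreath:
  assumes "x \<in> X" "y \<in> X" "x \<noteq> y"
  shows "AutPM_group (X \<times> X) rect \<cong> wreath_Z2 (symmetric_group X)"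
proof -
  let ?G = "symmetric_group X \<times>\<times> symmetric_group X"
  have eqs: "?G\<lparr>carrier := Sym X \<times> Sym X\<rparr> = ?G"
    "(AutPM_group (X \<times> X) rect)\<lparr>carrier := AutPM (X \<times> X) rect\<rparr> = AutPM_group (X \<times> X) rect"
    by (simp_all add: DirProd_def AutPM_group_def)
  have "(AutPM_group (X \<times> X) rect)\<lparr>carrier := AutPM (X \<times> X) rect\<rparr> \<cong>
      semidirect (?G\<lparr>carrier := Sym X \<times> Sym X\<rparr>) Z2 swap_action"
    by (rule gam_del_group_iso_semidirect[OF assms]) (auto simp: AutPM_rect permutes_compose)
  then show ?thesis unfolding eqs wreath_Z2_def .
qed

lemma InvGen_group_rect_iso_semidirect:
  assumes fin: "finite X" and "x \<in> X" "y \<in> X" "x \<noteq> y"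
  shows "InvGen_group (X \<times> X) rect \<cong> semidirect (EvenPairs_group X) Z2 swap_action"
  unfolding InvGen_group_def EvenPairs_group_def
  by (rule gam_del_group_iso_semidirect[OF assms(2-4)])
    (auto simp: InvGen_rect_finite[OF fin] EvenPairs_comp[OF fin] EvenPairs_swap[OF fin],
      auto simp: EvenPairs_iff[OF fin])

section \<open>The group of pairs of equal parity\<close>

lemma group_Sym_Sym: "group (symmetric_group X \<times>\<times> symmetric_group X)"
  by (simp add: DirProd_group group_symmetric_group)

lemma inv_Sym_Sym:
  "\<sigma> permutes X \<Longrightarrow> \<tau> permutes X \<Longrightarrow>
    m_inv (symmetric_group X \<times>\<times> symmetric_group X) (\<sigma>, \<tau>) = (inv' \<sigma>, inv' \<tau>)"
  by (simp add: group_symmetric_group inv_symmetric_group)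

lemma subgroup_EvenPairs:
  assumes fin: "finite X"
  shows "subgroup (EvenPairs X) (symmetric_group X \<times>\<times> symmetric_group X)"
proof (rule group.subgroupI[OF group_Sym_Sym])
  have "(id, id) \<in> EvenPairs X" by (simp add: EvenPairs_iff[OF fin])
  then show "EvenPairs X \<noteq> {}" by blast
qed (use fin in \<open>auto simp: EvenPairs_iff inv_Sym_Sym permutes_inv permutes_compose
      evenperm_comp_permutes evenperm_inv_permutes simp del: inv_DirProd\<close>)

lemma subgroup_Alt_Alt:
  assumes fin: "finite X"
  shows "subgroup (Alt X \<times> Alt X) (symmetric_group X \<times>\<times> symmetric_group X)"
proof (rule group.subgroupI[OF group_Sym_Sym])
  have "(id, id) \<in> Alt X \<times> Alt X" by (simp add: Alt_iff)
  then show "Alt X \<times> Alt X \<noteq> {}" by blast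
qed (use fin in \<open>auto simp: Alt_iff inv_Sym_Sym permutes_inv permutes_compose
      evenperm_inv_permutes evenperm_comp_permutes simp del: inv_DirProd\<close>)

text \<open>The order divides 2 exactly if the square is the identity, and 1 is the only other
  divisor of 2.\<close>

lemma ord_symmetric_group_eq_2_iff:
  assumes p: "p permutes X"
  shows "group.ord (symmetric_group X) p = 2 \<longleftrightarrow> p \<circ> p = id \<and> p \<noteq> id"
proof -
  interpret group "symmetric_group X" by (rule group_symmetric_group)
  have mem: "p \<in> carrier (symmetric_group X)" using p by simp
  have "p [^]\<^bsub>symmetric_group X\<^esub> (2::nat) = p \<circ> p"
    by (simp add: numeral_2_eq_2)
  then have "p \<circ> p = id \<longleftrightarrow> ord p dvd 2" using pow_eq_id[OF mem, of 2] by simp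
  moreover have "p = id \<longleftrightarrow> ord p = 1" using ord_eq_1[OF mem] by simp
  moreover have "n dvd 2 \<and> n \<noteq> 1 \<longleftrightarrow> n = 2" for n :: nat
  proof safe
    assume "n dvd 2" "n \<noteq> 1"
    moreover have "n \<le> 2" using \<open>n dvd 2\<close> by (rule dvd_imp_le) simp
    moreover have "n \<noteq> 0" using dvd_pos_nat[OF _ \<open>n dvd 2\<close>] by simp
    ultimately show "n = 2" by linarith
  qed auto
  ultimately show ?thesis by auto
qed

text \<open>Listing the two elements turns the later claims about this cyclic group into direct
  computations.\<close>

lemma generate_diagonal_involution:
  assumes "p permutes X" "p \<circ> p = id"
  shows "generate (symmetric_group X \<times>\<times> symmetric_group X) {(p, p)} = {(id, id), (p, p)}"
    (is "generate ?G _ = _")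
proof (intro equalityI subsetI)
  have "inv' p = p" using assms by (simp add: inv_unique_comp)
  fix q assume "q \<in> generate ?G {(p, p)}"
  then show "q \<in> {(id, id), (p, p)}"
  proof (induction rule: generate.induct)
    case (inv h)
    then show ?case using \<open>inv' p = p\<close> assms by (simp add: inv_Sym_Sym del: inv_DirProd)
  next
    case (eng h1 h2)
    then show ?case
      by (elim insertE emptyE) (simp_all only: mult_DirProd mult_symmetric_group comp_id id_comp
          assms(2) insert_iff simp_thms)
  qed (simp_all only: one_DirProd one_symmetric_group insert_iff simp_thms)
next
  fix q assume "q \<in> {(id, id), (p, p)}"
  then show "q \<in> generate ?G {(p, p)}"
    using generate.one[of ?G "{(p, p)}"] generate.incl[of "(p, p)" "{(p, p)}" ?G]
    by (elim insertE emptyE) simp_all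
qed

text \<open>A pair of equal parity is even-even or odd-odd. The odd-odd pair \<open>(p, p)\<close>
  lies outside \<open>Alt X \<times> Alt X\<close>, and multiplying by it exchanges the two
  kinds.\<close>

lemma internal_semidirect_EvenPairs:
  assumes fin: "finite X" and p: "p permutes X" "\<not> evenperm p" "p \<circ> p = id"
  shows "internal_semidirect (EvenPairs_group X) (Alt X \<times> Alt X) {(id, id), (p, p)}"
proof -
  let ?G = "symmetric_group X \<times>\<times> symmetric_group X"
  interpret G: group ?G by (rule group_Sym_Sym)
  interpret E: group "EvenPairs_group X"
    unfolding EvenPairs_group_def using subgroup_EvenPairs[OF fin] group_Sym_Sym
    by (rule subgroup.subgroup_is_group)
  have carrier_E: "carrier (EvenPairs_group X) = EvenPairs X"
    and mult_E: "a \<otimes>\<^bsub>EvenPairs_group X\<^esub> b = (fst a \<circ> fst b, snd a \<circ> snd b)" for a b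
    by (simp_all add: EvenPairs_group_def mult_DirProd')
  have inv_E: "m_inv (EvenPairs_group X) (\<sigma>, \<tau>) = (inv' \<sigma>, inv' \<tau>)"
    if "(\<sigma>, \<tau>) \<in> EvenPairs X" for \<sigma> \<tau>
    using G.m_inv_consistent[OF subgroup_EvenPairs[OF fin] that] that
    by (simp add: EvenPairs_group_def EvenPairs_iff[OF fin] inv_Sym_Sym del: inv_DirProd)
  have "subgroup (Alt X \<times> Alt X) (EvenPairs_group X)"
    unfolding EvenPairs_group_def
    by (rule G.subgroup_incl[OF subgroup_Alt_Alt[OF fin] subgroup_EvenPairs[OF fin]])
      (auto simp: Alt_iff EvenPairs_iff[OF fin])
  then have "(Alt X \<times> Alt X) \<lhd> EvenPairs_group X"
    unfolding E.normal_inv_iff carrier_E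
    using fin by (auto simp: mult_E inv_E Alt_iff EvenPairs_iff permutes_compose permutes_inv
        evenperm_comp_permutes evenperm_inv_permutes)
  moreover have "subgroup {(id, id), (p, p)} (EvenPairs_group X)"
    unfolding EvenPairs_group_def generate_diagonal_involution[OF p(1,3), symmetric]
  proof (rule G.subgroup_incl[OF G.generate_is_subgroup subgroup_EvenPairs[OF fin]])
    show "generate ?G {(p, p)} \<subseteq> EvenPairs X"
      unfolding generate_diagonal_involution[OF p(1,3)]
      using p by (simp add: EvenPairs_iff[OF fin])
  qed (use p in simp)
  moreover have "(Alt X \<times> Alt X) \<inter> {(id, id), (p, p)} = {\<one>\<^bsub>EvenPairs_group X\<^esub>}"
    using p by (auto simp: EvenPairs_group_def Alt_iff)
  moreover have "(Alt X \<times> Alt X) <#>\<^bsub>EvenPairs_group X\<^esub> {(id, id), (p, p)}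
      = carrier (EvenPairs_group X)"
  proof (intro equalityI subsetI)
    fix q assume "q \<in> (Alt X \<times> Alt X) <#>\<^bsub>EvenPairs_group X\<^esub> {(id, id), (p, p)}"
    then show "q \<in> carrier (EvenPairs_group X)"
      using p fin by (auto simp: set_mult_def mult_E carrier_E EvenPairs_iff Alt_iff
          permutes_compose evenperm_comp_permutes)
  next
    fix q assume "q \<in> carrier (EvenPairs_group X)"
    then obtain \<sigma> \<tau> where q: "q = (\<sigma>, \<tau>)" "(\<sigma>, \<tau>) \<in> EvenPairs X"
      by (cases q) (auto simp: carrier_E)
    show "q \<in> (Alt X \<times> Alt X) <#>\<^bsub>EvenPairs_group X\<^esub> {(id, id), (p, p)}"
    proof (cases "evenperm \<sigma>")
      case True
      then have "(\<sigma>, \<tau>) \<in> Alt X \<times> Alt X" using q by (auto simp: EvenPairs_iff[OF fin] Alt_iff)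
      then show ?thesis using q unfolding set_mult_def by (force simp: mult_E)
    next
      case False
      then have "(\<sigma> \<circ> p, \<tau> \<circ> p) \<in> Alt X \<times> Alt X"
        using q p fin by (auto simp: EvenPairs_iff Alt_iff permutes_compose evenperm_comp_permutes)
      moreover have "q = (\<sigma> \<circ> p, \<tau> \<circ> p) \<otimes>\<^bsub>EvenPairs_group X\<^esub> (p, p)"
        using p(3) by (simp add: q mult_E comp_assoc)
      ultimately show ?thesis unfolding set_mult_def by blast
    qed
  qed
  ultimately show ?thesis unfolding internal_semidirect_def by blast
qed

lemma diagonal_involution_group_iso_Z2:
  assumes "p \<circ> p = id" "p \<noteq> id"
  shows "(symmetric_group X \<times>\<times> symmetric_group X)\<lparr>carrier := {(id, id), (p, p)}\<rparr> \<cong> Z2"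
proof -
  have "carrier Z2 = {0, 1}" by (auto simp: carrier_integer_mod_group)
  then have "(\<lambda>q. if q = (id, id) then 0 else 1) \<in>
      iso ((symmetric_group X \<times>\<times> symmetric_group X)\<lparr>carrier := {(id, id), (p, p)}\<rparr>) Z2"
    using assms by (auto simp: iso_def hom_def bij_betw_def inj_on_def)
  then show ?thesis by (auto simp: is_iso_def)
qed

text \<open>The hypothesis of two distinct points excludes the degenerate bands: with at most one
  point there is no involution and \<open>AutPM\<close> is trivial, while the products with
  \<open>Z2\<close> have order 2. Nonemptiness in the first clause excludes the empty band, whose
  identity is an anti-automorphism.\<close>

theorem mainTheorem10:
  fixes X :: "'a set" and Y :: "'b set"
  shows
    "(X \<noteq> {} \<and> Y \<noteq> {} \<and> \<not> X \<approx> Y \<longrightarrow>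
        AntiAut (X \<times> Y) rect = {} \<and> InvGen (X \<times> Y) rect = {id})
     \<and> (X \<approx> Y \<longrightarrow> semigroup_isomorphic (X \<times> Y) rect (X \<times> X) rect)
     \<and> Aut (X \<times> X) rect = {gam X \<sigma> \<tau> | \<sigma> \<tau>. \<sigma> \<in> Sym X \<and> \<tau> \<in> Sym X}
     \<and> AntiAut (X \<times> X) rect = {del X \<sigma> \<tau> | \<sigma> \<tau>. \<sigma> \<in> Sym X \<and> \<tau> \<in> Sym X}
     \<and> AutPM (X \<times> X) rect =
          {gam X \<sigma> \<tau> | \<sigma> \<tau>. \<sigma> \<in> Sym X \<and> \<tau> \<in> Sym X} \<union>
          {del X \<sigma> \<tau> | \<sigma> \<tau>. \<sigma> \<in> Sym X \<and> \<tau> \<in> Sym X}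
     \<and> Aut_group (X \<times> X) rect \<cong> symmetric_group X \<times>\<times> symmetric_group X
     \<and> ((\<exists>x\<in>X. \<exists>y\<in>X. x \<noteq> y) \<longrightarrow>
          Involutions (X \<times> X) rect = {del X \<sigma> (inv' \<sigma>) | \<sigma>. \<sigma> \<in> Sym X}
          \<and> AutPM_group (X \<times> X) rect \<cong> wreath_Z2 (symmetric_group X))
     \<and> (infinite X \<longrightarrow>
          InvGen (X \<times> X) rect = AutPM (X \<times> X) rect
          \<and> InvGen_group (X \<times> X) rect \<cong> wreath_Z2 (symmetric_group X))
     \<and> (finite X \<longrightarrow>
          InvGen (X \<times> X) rect =
            {gam X \<sigma> \<tau> | \<sigma> \<tau>. \<sigma> \<in> Sym X \<and> \<tau> \<in> Sym X \<and> \<sigma> \<circ> \<tau> \<in> Alt X} \<union>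
            {del X \<sigma> \<tau> | \<sigma> \<tau>. \<sigma> \<in> Sym X \<and> \<tau> \<in> Sym X \<and> \<sigma> \<circ> \<tau> \<in> Alt X}
          \<and> subgroup (EvenPairs X) (symmetric_group X \<times>\<times> symmetric_group X)
          \<and> ((\<exists>x\<in>X. \<exists>y\<in>X. x \<noteq> y) \<longrightarrow>
               InvGen_group (X \<times> X) rect \<cong> semidirect (EvenPairs_group X) Z2 swap_action
               \<and> (\<exists>\<pi>\<in>Sym X - Alt X. group.ord (symmetric_group X) \<pi> = 2))
          \<and> (\<forall>\<pi>\<in>Sym X - Alt X. group.ord (symmetric_group X) \<pi> = 2 \<longrightarrow>
               internal_semidirect (EvenPairs_group X) (Alt X \<times> Alt X)
                 (generate (symmetric_group X \<times>\<times> symmetric_group X) {(\<pi>, \<pi>)})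
               \<and> (symmetric_group X \<times>\<times> symmetric_group X)
                   \<lparr>carrier := generate (symmetric_group X \<times>\<times> symmetric_group X) {(\<pi>, \<pi>)}\<rparr>
                   \<cong> Z2))"
proof (intro conjI impI ballI)
  assume *: "X \<noteq> {} \<and> Y \<noteq> {} \<and> \<not> X \<approx> Y"
  then obtain a b where ab: "a \<in> X" "b \<in> Y" by blast
  have "\<alpha> \<notin> AntiAut (X \<times> Y) rect" for \<alpha>
    using * AntiAut_rect_imp_eqpoll[OF _ ab] by metis
  then show anti: "AntiAut (X \<times> Y) rect = {}" by auto
  have "Involutions (X \<times> Y) rect = {}" by (simp add: Involutions_def anti)
  then show "InvGen (X \<times> Y) rect = {id}" by (rule InvGen_eq_id_if_no_Involutions)
next
  assume "X \<approx> Y"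
  then show "semigroup_isomorphic (X \<times> Y) rect (X \<times> X) rect"
    by (rule eqpoll_imp_semigroup_isomorphic_rect)
next
  assume "\<exists>x\<in>X. \<exists>y\<in>X. x \<noteq> y"
  then obtain x y where xy: "x \<in> X" "y \<in> X" "x \<noteq> y" by blast
  show "Involutions (X \<times> X) rect = {del X \<sigma> (inv' \<sigma>) | \<sigma>. \<sigma> \<in> Sym X}"
    using xy by (rule Involutions_rect)
  show "AutPM_group (X \<times> X) rect \<cong> wreath_Z2 (symmetric_group X)"
    using xy by (rule AutPM_group_rect_iso_wreath)
next
  assume inf: "infinite X"
  then show InvGen: "InvGen (X \<times> X) rect = AutPM (X \<times> X) rect"
    by (rule InvGen_rect_infinite)
  obtain x y where xy: "x \<in> X" "y \<in> X" "x \<noteq> y"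
    using inf by (rule infinite_obtain_two)
  have "InvGen_group (X \<times> X) rect = AutPM_group (X \<times> X) rect"
    by (simp add: InvGen_group_def InvGen AutPM_group_def)
  then show "InvGen_group (X \<times> X) rect \<cong> wreath_Z2 (symmetric_group X)"
    using AutPM_group_rect_iso_wreath[OF xy] by simp
next
  assume fin: "finite X"
  have "(\<sigma>, \<tau>) \<in> EvenPairs X \<longleftrightarrow> \<sigma> \<in> Sym X \<and> \<tau> \<in> Sym X \<and> \<sigma> \<circ> \<tau> \<in> Alt X" for \<sigma> \<tau>
    by (simp add: EvenPairs_def)
  then show "InvGen (X \<times> X) rect =
      {gam X \<sigma> \<tau> | \<sigma> \<tau>. \<sigma> \<in> Sym X \<and> \<tau> \<in> Sym X \<and> \<sigma> \<circ> \<tau> \<in> Alt X} \<union>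
      {del X \<sigma> \<tau> | \<sigma> \<tau>. \<sigma> \<in> Sym X \<and> \<tau> \<in> Sym X \<and> \<sigma> \<circ> \<tau> \<in> Alt X}"
    using InvGen_rect_finite[OF fin] by (simp only:)
  show "subgroup (EvenPairs X) (symmetric_group X \<times>\<times> symmetric_group X)"
    using fin by (rule subgroup_EvenPairs)
next
  assume fin: "finite X" and "\<exists>x\<in>X. \<exists>y\<in>X. x \<noteq> y"
  then obtain x y where xy: "x \<in> X" "y \<in> X" "x \<noteq> y" by blast
  show "InvGen_group (X \<times> X) rect \<cong> semidirect (EvenPairs_group X) Z2 swap_action"
    using fin xy by (rule InvGen_group_rect_iso_semidirect)
  \<comment> \<open>A transposition of two distinct points is the witness for an odd permutation of
    order 2.\<close>
  have perm: "transpose x y permutes X" using xy(1,2) by (rule permutes_swap_id)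
  have "transpose x y \<noteq> id" using xy(3) by (metis id_apply transpose_apply_first)
  then have "group.ord (symmetric_group X) (transpose x y) = 2"
    using ord_symmetric_group_eq_2_iff[OF perm] by simp
  moreover have "transpose x y \<in> Sym X - Alt X"
    using perm xy(3) by (simp add: Alt_iff evenperm_swap)
  ultimately show "\<exists>\<pi>\<in>Sym X - Alt X. group.ord (symmetric_group X) \<pi> = 2" by blast
next
  fix \<pi> assume fin: "finite X" and "\<pi> \<in> Sym X - Alt X"
    and ord: "group.ord (symmetric_group X) \<pi> = 2"
  then have \<pi>: "\<pi> permutes X" "\<not> evenperm \<pi>" by (auto simp: Alt_iff)
  then have invol: "\<pi> \<circ> \<pi> = id" "\<pi> \<noteq> id" using ord_symmetric_group_eq_2_iff ord by blast+
  note generate = generate_diagonal_involution[OF \<pi>(1) invol(1)]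
  show "internal_semidirect (EvenPairs_group X) (Alt X \<times> Alt X)
      (generate (symmetric_group X \<times>\<times> symmetric_group X) {(\<pi>, \<pi>)})"
    unfolding generate using fin \<pi> invol(1) by (rule internal_semidirect_EvenPairs)
  show "(symmetric_group X \<times>\<times> symmetric_group X)
      \<lparr>carrier := generate (symmetric_group X \<times>\<times> symmetric_group X) {(\<pi>, \<pi>)}\<rparr> \<cong> Z2"
    unfolding generate using invol by (rule diagonal_involution_group_iso_Z2)
qed (rule Aut_rect AntiAut_rect AutPM_rect Aut_group_rect_iso)+

end
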